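(* There is an algorithm which, given the coefficients of a monic univariate polynomial $p\in\mathbb{R}[x]$ of degree $d\ge 1$, decides whether $p(x)\ge 0$ for all $x\in\mathbb{R}$ using at most $O(d^2)$ elementary operations on real numbers, where the implied constant is absolute.
   Context: The computational model is exact arithmetic on real numbers: each addition, subtraction, multiplication, division, and comparison/sign test of real numbers counts as one elementary operation. *)

theory Defs
  imports "HOL-Computational_Algebra.Polynomial"
begin

text \<open>
  A uniform real RAM in exact arithmetic, presented as a structured imperative language. A program
  works on named registers holding natural numbers (control and addressing) and on named arrays of
  real numbers. Reals enter the control flow only through the tests in \<open>bexp\<close>, and natural numbers
  are never converted to reals. Since the program is a finite object chosen independently of the
  degree, this is a single algorithm for all inputs, not a family of computation trees.
\<close>

type_synonym name = string
type_synonym state = "(name \<Rightarrow> nat) \<times> (name \<Rightarrow> nat \<Rightarrow> real)"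

text \<open>Subtraction on natural numbers is truncated.\<close>

datatype nexp = N nat | V name | Plus nexp nexp | Minus nexp nexp | Times nexp nexp

datatype loc = Cell name nexp

datatype arith = Add | Sub | Mul | Div

datatype bexp =
    NLess nexp nexp
  | RLess loc loc
  | REq loc loc
  | Not bexp
  | And bexp bexp

text \<open>Only rational literals are allowed as real constants: an arbitrary real could encode advice.\<close>

datatype com =
    Skip
  | NAssign name nexp
  | RConst loc rat
  | RCopy loc loc
  | ROp arith loc loc loc
  | Seq com com
  | If bexp com com
  | While bexp com

fun nval :: "nexp \<Rightarrow> state \<Rightarrow> nat" where
  "nval (N k) s = k"
| "nval (V x) s = fst s x"
| "nval (Plus a b) s = nval a s + nval b s"
| "nval (Minus a b) s = nval a s - nval b s"
| "nval (Times a b) s = nval a s * nval b s"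

fun rval :: "loc \<Rightarrow> state \<Rightarrow> real" where
  "rval (Cell x a) s = snd s x (nval a s)"

fun bval :: "bexp \<Rightarrow> state \<Rightarrow> bool" where
  "bval (NLess a b) s = (nval a s < nval b s)"
| "bval (RLess l m) s = (rval l s < rval m s)"
| "bval (REq l m) s = (rval l s = rval m s)"
| "bval (Not b) s = (\<not> bval b s)"
| "bval (And b c) s = (bval b s \<and> bval c s)"

text \<open>Both conjuncts are evaluated, hence both are charged.\<close>

fun bcost :: "bexp \<Rightarrow> nat" where
  "bcost (NLess a b) = 0"
| "bcost (RLess l m) = 1"
| "bcost (REq l m) = 1"
| "bcost (Not b) = bcost b"
| "bcost (And b c) = bcost b + bcost c"

fun arith_val :: "arith \<Rightarrow> real \<Rightarrow> real \<Rightarrow> real" where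
  "arith_val Add x y = x + y"
| "arith_val Sub x y = x - y"
| "arith_val Mul x y = x * y"
| "arith_val Div x y = x / y"

fun nupdate :: "name \<Rightarrow> nat \<Rightarrow> state \<Rightarrow> state" where
  "nupdate x k (\<nu>, \<rho>) = (\<nu>(x := k), \<rho>)"

fun rupdate :: "loc \<Rightarrow> real \<Rightarrow> state \<Rightarrow> state" where
  "rupdate (Cell x a) r (\<nu>, \<rho>) = (\<nu>, \<rho>(x := (\<rho> x)(nval a (\<nu>, \<rho>) := r)))"

text \<open>
  \<open>exec c s n t\<close>: started in \<open>s\<close>, the program \<open>c\<close> terminates in \<open>t\<close> after exactly \<open>n\<close> elementary
  operations on real numbers. Operations on natural numbers and data movement are not elementary
  operations on reals and cost nothing. A division by zero has no successor state, so the
  convention \<open>x / 0 = 0\<close> of HOL is not available to programs.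
\<close>

inductive exec :: "com \<Rightarrow> state \<Rightarrow> nat \<Rightarrow> state \<Rightarrow> bool" where
  Skip: "exec Skip s 0 s"
| NAssign: "exec (NAssign x a) s 0 (nupdate x (nval a s) s)"
| RConst: "exec (RConst l q) s 0 (rupdate l (of_rat q) s)"
| RCopy: "exec (RCopy l m) s 0 (rupdate l (rval m s) s)"
| ROp: "(f = Div \<Longrightarrow> rval m' s \<noteq> 0) \<Longrightarrow>
    exec (ROp f l m m') s 1 (rupdate l (arith_val f (rval m s) (rval m' s)) s)"
| Seq: "exec c s n s' \<Longrightarrow> exec c' s' n' t \<Longrightarrow> exec (Seq c c') s (n + n') t"
| IfTrue: "bval b s \<Longrightarrow> exec c s n t \<Longrightarrow> exec (If b c c') s (bcost b + n) t"
| IfFalse: "\<not> bval b s \<Longrightarrow> exec c' s n t \<Longrightarrow> exec (If b c c') s (bcost b + n) t"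
| WhileFalse: "\<not> bval b s \<Longrightarrow> exec (While b c) s (bcost b) s"
| WhileTrue: "bval b s \<Longrightarrow> exec c s n s' \<Longrightarrow> exec (While b c) s' n' t \<Longrightarrow>
    exec (While b c) s (bcost b + n + n') t"

text \<open>
  Execution is deterministic, so exhibiting one terminating run from an input determines the
  output and the number of operations on that input.
\<close>

inductive_cases exec_basic:
  "exec Skip s n t" "exec (NAssign x a) s n t" "exec (RConst l q) s n t" "exec (RCopy l m) s n t"
  "exec (ROp f l m m') s n t"

inductive_cases exec_Seq: "exec (Seq c c') s n t"
inductive_cases exec_If: "exec (If b c c') s n t"
inductive_cases exec_While: "exec (While b c) s n t"

lemma exec_deterministic:
  assumes "exec c s n t" "exec c s n' t'"
  shows "n' = n \<and> t' = t"
  using assms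
proof (induction arbitrary: n' t' rule: exec.induct)
  case (Seq c s n s1 c' m t)
  from Seq.prems obtain k s2 k' where run: "n' = k + k'" "exec c s k s2" "exec c' s2 k' t'"
    by (rule exec_Seq)
  have "k = n \<and> s2 = s1" by (rule Seq.IH(1)[OF run(2)])
  moreover from this run(3) have "k' = m \<and> t' = t" by (intro Seq.IH(2)) simp
  ultimately show ?case using run(1) by simp
next
  case (WhileFalse b s c)
  from WhileFalse.prems show ?case
    by (rule exec_While) (simp_all add: WhileFalse.hyps)
next
  case (WhileTrue b s c n s1 m t)
  from WhileTrue.prems obtain k s2 k'
    where run: "n' = bcost b + k + k'" "exec c s k s2" "exec (While b c) s2 k' t'"
    by (rule exec_While) (simp_all add: WhileTrue.hyps)
  have "k = n \<and> s2 = s1" by (rule WhileTrue.IH(1)[OF run(2)])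
  moreover from this run(3) have "k' = m \<and> t' = t" by (intro WhileTrue.IH(2)) simp
  ultimately show ?case using run(1) by simp
next
  case (IfTrue b s c n t c')
  from IfTrue.prems IfTrue.hyps obtain k where run: "n' = bcost b + k" "exec c s k t'"
    by (elim exec_If) simp_all
  from IfTrue.IH[OF run(2)] run(1) show ?case by simp
next
  case (IfFalse b s c' n t c)
  from IfFalse.prems IfFalse.hyps obtain k where run: "n' = bcost b + k" "exec c' s k t'"
    by (elim exec_If) simp_all
  from IfFalse.IH[OF run(2)] run(1) show ?case by simp
qed (erule exec_basic, simp)+

text \<open>All memory not holding the degree or a coefficient is \<open>0\<close>; note that \<open>coeff p\<close> is \<open>0\<close> beyond the degree.\<close>

definition input_state :: "real poly \<Rightarrow> state" where
  "input_state p =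
     ((\<lambda>x. 0)(''d'' := degree p), (\<lambda>x i. 0)(''p'' := coeff p))"

definition accepting :: "state \<Rightarrow> bool" where
  "accepting t \<longleftrightarrow> fst t ''result'' = 1"

definition rejecting :: "state \<Rightarrow> bool" where
  "rejecting t \<longleftrightarrow> fst t ''result'' = 0"

end

theory Submission
  imports Defs
begin

text \<open>
  A monic \<open>p\<close> is nonnegative iff no real root has odd multiplicity. With \<open>g\<^sub>0 = p\<close> and
  \<open>g\<^bsub>k+1\<^esub> = gcd(g\<^sub>k, g\<^sub>k')\<close>, the roots of \<open>g\<^sub>k\<close> are the roots of \<open>p\<close> of multiplicity greater than \<open>k\<close>,
  so the number of odd roots is the alternating sum of the numbers of distinct real roots of the
  \<open>g\<^sub>k\<close>. Each of these is the Cauchy index of \<open>g\<^sub>k'/g\<^sub>k\<close>. The index of \<open>f/g\<close> depends only on \<open>f\<close> modulo \<open>g\<close>,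
  and the indices of \<open>f/g\<close> and \<open>g/f\<close> add up to a quantity determined by degrees and leading
  coefficients. Hence Euclid's algorithm computes it, and it produces \<open>g\<^bsub>k+1\<^esub>\<close> on the way. One
  elimination step costs \<open>O(d)\<close> and the degrees drop by \<open>d\<close> in total over all the runs of Euclid's
  algorithm, whence \<open>O(d\<^sup>2)\<close>.
\<close>

section \<open>Lowest Taylor coefficients and sign changes\<close>

definition lowest :: "real \<Rightarrow> real poly \<Rightarrow> real" where
  "lowest x p = poly (p div [:-x, 1:] ^ order x p) x"

lemma linear_power_mult_order:
  fixes q :: "real poly"
  assumes "poly q x \<noteq> 0"
  shows "order x ([:-x, 1:] ^ k * q) = k"
proof -
  have "q \<noteq> 0" using assms by auto
  then have "order x ([:-x, 1:] ^ k * q) = order x ([:-x, 1:] ^ k) + order x q"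
    by (intro order_mult) simp
  then show ?thesis by (simp only: order_power_n_n order_0I[OF assms] add_0_right)
qed

lemma lowest_linear_power_mult:
  assumes "poly q x \<noteq> 0"
  shows "lowest x ([:-x, 1:] ^ k * q) = poly q x"
  unfolding lowest_def linear_power_mult_order[OF assms] by simp

lemma order_lowest_decomp:
  assumes "p \<noteq> 0"
  obtains q where "p = [:-x, 1:] ^ order x p * q" "poly q x = lowest x p" "poly q x \<noteq> 0"
proof -
  obtain q where q: "p = [:-x, 1:] ^ order x p * q" "\<not> [:-x, 1:] dvd q"
    using order_decomp[OF assms] by blast
  then have nz: "poly q x \<noteq> 0" by (simp add: poly_eq_0_iff_dvd)
  have "lowest x p = poly q x"
    using lowest_linear_power_mult[OF nz, of "order x p"] q(1) by simp
  with q nz show ?thesis using that by auto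
qed

lemma lowest_nonzero: "p \<noteq> 0 \<Longrightarrow> lowest x p \<noteq> 0"
  by (metis order_lowest_decomp)

lemma lowest_mult:
  assumes "p \<noteq> 0" "q \<noteq> 0"
  shows "lowest x (p * q) = lowest x p * lowest x q"
proof -
  obtain p' where p': "p = [:-x, 1:] ^ order x p * p'" "poly p' x = lowest x p" "poly p' x \<noteq> 0"
    using order_lowest_decomp[OF assms(1)] .
  obtain q' where q': "q = [:-x, 1:] ^ order x q * q'" "poly q' x = lowest x q" "poly q' x \<noteq> 0"
    using order_lowest_decomp[OF assms(2)] .
  have "p * q = ([:-x, 1:] ^ order x p * p') * ([:-x, 1:] ^ order x q * q')"
    using p'(1) q'(1) by simp
  also have "\<dots> = [:-x, 1:] ^ (order x p + order x q) * (p' * q')"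
    by (simp only: power_add mult_ac)
  finally show ?thesis
    using lowest_linear_power_mult[of "p' * q'" x "order x p + order x q"] p' q' by simp
qed

text \<open>Differentiating \<open>(X - x)^(n+1) * q\<close> gives \<open>(X - x)^n\<close> times
  \<open>(n+1) * q + (X - x) * q'\<close>, and this cofactor takes the nonzero value
  \<open>(n+1) * q(x)\<close> at \<open>x\<close>.\<close>

lemma order_lowest_pderiv:
  assumes "order x p = Suc n" "p \<noteq> 0"
  shows "order x (pderiv p) = n \<and> lowest x (pderiv p) = real (Suc n) * lowest x p"
proof -
  obtain q where q: "p = [:-x, 1:] ^ Suc n * q" "poly q x = lowest x p" "poly q x \<noteq> 0"
    using order_lowest_decomp[OF assms(2)] assms(1) by metis
  define r where "r = smult (of_nat (Suc n)) q + [:-x, 1:] * pderiv q"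
  have "pderiv p = [:-x, 1:] ^ Suc n * pderiv q
      + smult (of_nat (Suc n)) (q * [:-x, 1:] ^ n)"
    unfolding q(1) by (rule lemma_order_pderiv1)
  also have "\<dots> = [:-x, 1:] ^ n * r"
    unfolding r_def by (simp add: algebra_simps)
  finally have d: "pderiv p = [:-x, 1:] ^ n * r" .
  have r: "poly r x = real (Suc n) * lowest x p" unfolding r_def using q(2) by simp
  then have "poly r x \<noteq> 0" using q by simp
  then show ?thesis unfolding d
    using linear_power_mult_order lowest_linear_power_mult r by metis
qed

text \<open>One more power of \<open>X - x\<close> divides \<open>q\<close> than \<open>p\<close>,
  so the cofactor of \<open>p\<close> changes only by a multiple of \<open>X - x\<close>. The case
  \<open>q = 0\<close> is separate because \<open>order x 0\<close> is unspecified.\<close>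

lemma order_lowest_add:
  assumes "p \<noteq> 0" "q = 0 \<or> order x p < order x q"
  shows "p + q \<noteq> 0 \<and> order x (p + q) = order x p \<and> lowest x (p + q) = lowest x p"
proof -
  obtain p' where p': "p = [:-x, 1:] ^ order x p * p'" "poly p' x = lowest x p" "poly p' x \<noteq> 0"
    using order_lowest_decomp[OF assms(1)] .
  have "[:-x, 1:] ^ Suc (order x p) dvd q"
    unfolding order_divides using assms(2) by auto
  then obtain s where "q = [:-x, 1:] ^ Suc (order x p) * s" by (rule dvdE)
  then have "p + q = [:-x, 1:] ^ order x p * p' + [:-x, 1:] ^ Suc (order x p) * s"
    using p'(1) by simp
  also have "\<dots> = [:-x, 1:] ^ order x p * (p' + [:-x, 1:] * s)"
    by (simp only: power_Suc algebra_simps)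
  finally have e: "p + q = [:-x, 1:] ^ order x p * (p' + [:-x, 1:] * s)" .
  have v: "poly (p' + [:-x, 1:] * s) x = lowest x p" using p' by simp
  then have nz: "poly (p' + [:-x, 1:] * s) x \<noteq> 0" using p' by simp
  have "p' + [:-x, 1:] * s \<noteq> 0" using nz poly_0 by metis
  then have "p + q \<noteq> 0" unfolding e by (simp del: mult_pCons_left)
  then show ?thesis
    using linear_power_mult_order[OF nz, of "order x p"]
      lowest_linear_power_mult[OF nz, of "order x p"] v e by metis
qed

text \<open>Far to the right \<open>p\<close> has the sign of its leading coefficient; by the
  intermediate value theorem a different sign at \<open>x\<close> would force a root in
  between.\<close>

lemma sgn_poly_no_roots_ge:
  fixes p :: "real poly"
  assumes "\<And>y. y \<ge> x \<Longrightarrow> poly p y \<noteq> 0"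
  shows "sgn (poly p x) = sgn (lead_coeff p)"
proof -
  have pos: "poly q x > 0" if q: "lead_coeff q > 0" "\<And>y. y \<ge> x \<Longrightarrow> poly q y \<noteq> 0" for q :: "real poly"
  proof (rule ccontr)
    assume "\<not> poly q x > 0"
    with q(2)[of x] have neg: "poly q x < 0" by simp
    obtain n where n: "\<And>y. y \<ge> n \<Longrightarrow> poly q y \<ge> lead_coeff q"
      using poly_pinfty_gt_lc[OF q(1)] by blast
    define y where "y = max n (x + 1)"
    have "poly q y > 0" using n[of y] q(1) by (simp add: y_def)
    moreover have "x < y" by (simp add: y_def)
    ultimately obtain z where "x < z" "poly q z = 0"
      using poly_IVT_pos[OF _ neg] by blast
    with q(2)[of z] show False by simp
  qed
  have "p \<noteq> 0" using assms[of x] by auto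
  then consider "lead_coeff p > 0" | "lead_coeff (-p) > 0"
    using lead_coeff_minus[of p] leading_coeff_0_iff[of p] by linarith
  then show ?thesis
  proof cases
    case 1
    then show ?thesis using pos[of p] assms by simp
  next
    case 2
    then have "poly (-p) x > 0" using assms by (intro pos) auto
    with 2 show ?thesis by (simp add: lead_coeff_minus)
  qed
qed

text \<open>Neither \<open>p\<close> nor its reflection \<open>p(-X)\<close> has a root, so both
  have the sign of their leading coefficient at 0. They agree there, while the leading coefficients
  differ by the factor \<open>(-1)^degree p\<close>.\<close>

lemma even_degree_no_roots:
  fixes p :: "real poly"
  assumes "\<And>y. poly p y \<noteq> 0"
  shows "even (degree p)"
proof -
  define q where "q = pcompose p [:0, -1:]"
  have v: "poly q y = poly p (- y)" for y unfolding q_def by (simp add: poly_pcompose)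
  have "lead_coeff q = lead_coeff p * (-1) ^ degree p"
    unfolding q_def by (subst lead_coeff_comp) auto
  moreover have "sgn (poly q 0) = sgn (lead_coeff q)"
    using assms by (intro sgn_poly_no_roots_ge) (simp add: v)
  moreover have "sgn (poly p 0) = sgn (lead_coeff p)"
    using assms by (intro sgn_poly_no_roots_ge) simp
  moreover have "p \<noteq> 0" using assms[of 0] by auto
  ultimately show ?thesis
    by (cases "even (degree p)") (auto simp: v sgn_minus sgn_eq_0_iff)
qed

text \<open>\<open>sgn (lowest x p)\<close> is the sign of \<open>p\<close> just to the right of \<open>x\<close>, so \<open>crossing x p\<close> is half the
  change of \<open>sgn p\<close> at \<open>x\<close> and \<open>degree_crossing p\<close> half the change of \<open>sgn p\<close> from \<open>-\<infinity>\<close> to \<open>\<infinity>\<close>.\<close>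

definition crossing :: "real \<Rightarrow> real poly \<Rightarrow> real" where
  "crossing x p = (if odd (order x p) then sgn (lowest x p) else 0)"

definition degree_crossing :: "real poly \<Rightarrow> real" where
  "degree_crossing p = (if odd (degree p) then sgn (lead_coeff p) else 0)"

text \<open>Induction on the degree, splitting off the largest root \<open>a\<close> with its full
  multiplicity \<open>k\<close>. From \<open>a\<close> on, the cofactor \<open>q\<close> keeps the
  sign of its leading coefficient; left of \<open>a\<close>, the factor \<open>(X - a)^k\<close>
  multiplies every crossing by \<open>(-1)^k\<close>.\<close>

lemma sum_crossing:
  assumes "p \<noteq> 0"
  shows "(\<Sum>x | poly p x = 0. crossing x p) = degree_crossing p"
  using assms
proof (induction "degree p" arbitrary: p rule: less_induct)
  case less
  define Z where "Z = {x. poly p x = 0}"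
  have fin: "finite Z" unfolding Z_def using less.prems by (rule poly_roots_finite)
  show ?case
  proof (cases "Z = {}")
    case True
    then have "even (degree p)" by (intro even_degree_no_roots) (auto simp: Z_def)
    with True show ?thesis by (simp add: Z_def degree_crossing_def)
  next
    case False
    define a where "a = Max Z"
    have a: "a \<in> Z" unfolding a_def using fin False by simp
    have amax: "x \<le> a" if "x \<in> Z" for x unfolding a_def using fin that by simp
    define k where "k = order a p"
    obtain q where q: "p = [:-a, 1:] ^ k * q" "poly q a = lowest a p" "poly q a \<noteq> 0"
      using order_lowest_decomp[OF less.prems] unfolding k_def by metis
    have k: "k \<noteq> 0" using a less.prems unfolding Z_def k_def by (simp add: order_root)
    have q0: "q \<noteq> 0" using q(3) by auto
    have deg: "degree p = k + degree q"
      unfolding q(1) using q0 by (simp add: degree_mult_eq degree_linear_power)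
    have lc: "lead_coeff p = lead_coeff q"
      unfolding q(1) by (simp add: lead_coeff_mult lead_coeff_power)
    have ZZ: "Z = insert a {x. poly q x = 0}"
      unfolding Z_def q(1) using k by auto
    have fq: "finite {x. poly q x = 0}" using q0 by (rule poly_roots_finite)
    have low: "crossing x p = (-1) ^ k * crossing x q" if x: "poly q x = 0" for x
    proof -
      have "x \<in> Z" "x \<noteq> a" using ZZ x q(3) by auto
      then have xa: "x < a" using amax[of x] by simp
      have nz: "poly ([:-a, 1:] ^ k) x \<noteq> 0" using xa by simp
      have l: "lowest x ([:-a, 1:] ^ k) = (x - a) ^ k"
        using lowest_linear_power_mult[OF nz, of 0] by simp
      have "order x p = order x q"
        unfolding q(1) using order_0I[OF nz] q0 by (subst order_mult) auto
      moreover have "lowest x p = (x - a) ^ k * lowest x q"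
        unfolding q(1) using q0 l by (subst lowest_mult) auto
      moreover have "sgn ((x - a) ^ k) = (-1) ^ k"
        using xa by (induction k) (simp_all add: sgn_mult)
      ultimately show ?thesis by (simp add: crossing_def sgn_mult)
    qed
    have IH: "(\<Sum>x | poly q x = 0. crossing x q) = degree_crossing q"
      using less.hyps[of q] deg k q0 by simp
    have "(\<Sum>x\<in>Z. crossing x p) = crossing a p + (\<Sum>x | poly q x = 0. crossing x p)"
      unfolding ZZ using fq q(3) by simp
    also have "(\<Sum>x | poly q x = 0. crossing x p) = (\<Sum>x | poly q x = 0. (-1) ^ k * crossing x q)"
      by (rule sum.cong) (auto simp: low)
    also have "\<dots> = (-1) ^ k * degree_crossing q"
      unfolding sum_distrib_left[symmetric] IH ..
    finally have s: "(\<Sum>x\<in>Z. crossing x p) = crossing a p + (-1) ^ k * degree_crossing q" .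
    have "sgn (poly q a) = sgn (lead_coeff q)"
    proof (rule sgn_poly_no_roots_ge)
      fix y assume "y \<ge> a"
      show "poly q y \<noteq> 0"
      proof
        assume "poly q y = 0"
        then have "y \<in> Z" "y \<noteq> a" using ZZ q(3) by auto
        then show False using amax[of y] \<open>y \<ge> a\<close> by simp
      qed
    qed
    then have "crossing a p = (if odd k then sgn (lead_coeff q) else 0)"
      unfolding crossing_def k_def[symmetric] using q(2) by simp
    \<comment> \<open>For odd \<open>k\<close>, the sum is the sign of the leading coefficient minus
      \<open>degree_crossing q\<close>, which vanishes exactly when \<open>degree q\<close> is
      odd.\<close>
    then show ?thesis
      using s unfolding Z_def degree_crossing_def lc unfolding deg by auto
  qed
qed

section \<open>The Cauchy index\<close>

text \<open>The quotient \<open>f / g\<close> has the sign of \<open>f * g\<close>, so this is its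
  jump at a pole: \<open>1\<close> from minus to plus infinity, \<open>-1\<close> for the reverse,
  and \<open>0\<close> at poles of even order.\<close>

definition jump :: "real poly \<Rightarrow> real poly \<Rightarrow> real \<Rightarrow> real" where
  "jump f g x = (if f \<noteq> 0 \<and> order x f < order x g then crossing x (f * g) else 0)"

definition cauchy_index :: "real poly \<Rightarrow> real poly \<Rightarrow> real" where
  "cauchy_index f g = (\<Sum>x | poly g x = 0. jump f g x)"

lemma cauchy_index_0 [simp]: "cauchy_index 0 g = 0"
  by (simp add: cauchy_index_def jump_def)

lemma crossing_mult:
  assumes "f \<noteq> 0" "g \<noteq> 0"
  shows "crossing x (f * g) =
    (if odd (order x f + order x g) then sgn (lowest x f) * sgn (lowest x g) else 0)"
  using assms by (simp add: crossing_def lowest_mult order_mult sgn_mult)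

text \<open>At a pole of \<open>f / g\<close> the summand \<open>s * g\<close> has higher order than
  \<open>f\<close> and leaves its order and lowest coefficient alone. Elsewhere the full power of
  \<open>X - x\<close> in \<open>g\<close> divides both numerators.\<close>

lemma jump_add_mult:
  assumes "g \<noteq> 0"
  shows "jump (f + s * g) g x = jump f g x"
proof (cases "f \<noteq> 0 \<and> order x f < order x g")
  case True
  have "s * g = 0 \<or> order x f < order x (s * g)"
    using True order_mult[of s g x] by force
  from order_lowest_add[OF _ this] True assms show ?thesis
    by (simp add: jump_def crossing_mult)
next
  case False
  have "[:-x, 1:] ^ order x g dvd f + s * g"
    using False by (intro dvd_add dvd_mult order_1) (auto simp: order_divides)
  then have "\<not> (f + s * g \<noteq> 0 \<and> order x (f + s * g) < order x g)"
    by (auto simp: order_divides)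
  with False show ?thesis unfolding jump_def by (simp only: if_False)
qed

lemma cauchy_index_add_mult:
  "g \<noteq> 0 \<Longrightarrow> cauchy_index (f + s * g) g = cauchy_index f g"
  by (simp add: cauchy_index_def jump_add_mult)

lemma cauchy_index_superset:
  assumes "finite A" "{x. poly g x = 0} \<subseteq> A"
  shows "cauchy_index f g = (\<Sum>x\<in>A. jump f g x)"
  unfolding cauchy_index_def
proof (rule sum.mono_neutral_left[OF assms])
  show "\<forall>x\<in>A - {x. poly g x = 0}. jump f g x = 0"
    by (auto simp: jump_def order_0I)
qed

text \<open>At most one of \<open>f / g\<close> and \<open>g / f\<close> has a pole at
  \<open>x\<close>, and its jump is the crossing of \<open>f * g\<close>. With equal orders there is
  no pole, and the crossing is 0 because the total order is even. Then \<open>sum_crossing\<close>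
  applies.\<close>

lemma cauchy_index_inversion:
  assumes "f \<noteq> 0" "g \<noteq> 0"
  shows "cauchy_index f g = degree_crossing (f * g) - cauchy_index g f"
proof -
  define A where "A = {x. poly (f * g) x = 0}"
  have A: "finite A" "{x. poly f x = 0} \<subseteq> A" "{x. poly g x = 0} \<subseteq> A"
    unfolding A_def using assms poly_roots_finite[of "f * g"] by auto
  have "jump f g x + jump g f x = crossing x (f * g)" for x
    using assms by (auto simp: jump_def crossing_mult mult.commute)
  then have "(\<Sum>x\<in>A. jump f g x) + (\<Sum>x\<in>A. jump g f x) = degree_crossing (f * g)"
    using sum_crossing[of "f * g"] assms by (simp add: A_def sum.distrib[symmetric])
  then show ?thesis
    using cauchy_index_superset[OF A(1,3), of f] cauchy_index_superset[OF A(1,2), of g] by simp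
qed

text \<open>The logarithmic derivative has a simple pole with positive residue at every root, so
  each jump is 1.\<close>

lemma cauchy_index_pderiv:
  assumes "g \<noteq> 0"
  shows "cauchy_index (pderiv g) g = card {x. poly g x = 0}"
proof -
  have "jump (pderiv g) g x = 1" if root: "poly g x = 0" for x
  proof -
    obtain n where n: "order x g = Suc n"
      using root order_gt_0_iff[OF assms] gr0_conv_Suc by auto
    note d = order_lowest_pderiv[OF n assms]
    have g': "pderiv g \<noteq> 0"
      using n order_degree[OF assms, of x] by (auto simp: pderiv_eq_0_iff)
    have "sgn (lowest x g) * sgn (lowest x g) = 1"
      using lowest_nonzero[OF assms, of x] by (cases "lowest x g > 0") auto
    moreover have "sgn (lowest x (pderiv g)) = sgn (lowest x g)"
      using d by (simp add: sgn_mult del: of_nat_Suc)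
    ultimately show ?thesis
      unfolding jump_def crossing_mult[OF g' assms] using d n g' by simp
  qed
  then show ?thesis unfolding cauchy_index_def by simp
qed

section \<open>Common roots of odd multiplicity\<close>

text \<open>Counting powers of \<open>X - x\<close> up to the common multiplicity avoids both a gcd
  and the unspecified value of \<^term>\<open>order x 0\<close>.\<close>

definition common_order :: "real poly \<Rightarrow> real poly \<Rightarrow> real \<Rightarrow> nat" where
  "common_order f g x = card {k. [:-x, 1:] ^ Suc k dvd f \<and> [:-x, 1:] ^ Suc k dvd g}"

text \<open>For \<open>f\<close>, \<open>g\<close> not both zero, this counts the real roots of odd
  multiplicity of their gcd, a quantity that Euclid's algorithm preserves.\<close>

definition odd_roots :: "real poly \<Rightarrow> real poly \<Rightarrow> nat" where
  "odd_roots f g = card {x. odd (common_order f g x)}"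

lemma odd_roots_commute: "odd_roots f g = odd_roots g f"
  by (simp add: odd_roots_def common_order_def conj_commute)

lemma odd_roots_add_mult: "odd_roots (f + s * g) g = odd_roots f g"
proof -
  have "[:-x, 1:] ^ Suc k dvd f + s * g \<and> [:-x, 1:] ^ Suc k dvd g \<longleftrightarrow>
      [:-x, 1:] ^ Suc k dvd f \<and> [:-x, 1:] ^ Suc k dvd g" for x k
    by (metis dvd_add_left_iff dvd_mult)
  then show ?thesis unfolding odd_roots_def common_order_def by presburger
qed

lemma common_order_0:
  assumes "g \<noteq> 0"
  shows "common_order 0 g x = order x g"
proof -
  have "{k. [:-x, 1:] ^ Suc k dvd 0 \<and> [:-x, 1:] ^ Suc k dvd g} = {..<order x g}"
    unfolding order_divides using assms by auto
  then show ?thesis unfolding common_order_def by simp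
qed

text \<open>Differentiation lowers the multiplicity of a root by one; truncated subtraction gives
  the right value 0 at points that are not roots.\<close>

lemma common_order_pderiv:
  assumes "g \<noteq> 0"
  shows "common_order g (pderiv g) x = order x g - 1"
proof (cases "poly g x = 0")
  case True
  obtain n where n: "order x g = Suc n"
    using True order_gt_0_iff[OF assms] gr0_conv_Suc by auto
  have "pderiv g \<noteq> 0"
    using n order_degree[OF assms, of x] by (auto simp: pderiv_eq_0_iff)
  then have "{k. [:-x, 1:] ^ Suc k dvd g \<and> [:-x, 1:] ^ Suc k dvd pderiv g} = {..<n}"
    unfolding order_divides using assms n order_lowest_pderiv[OF n assms] by auto
  then show ?thesis unfolding common_order_def n by simp
next
  case False
  then have ord: "order x g = 0" by (rule order_0I)
  then have none: "{k. [:-x, 1:] ^ Suc k dvd g \<and> [:-x, 1:] ^ Suc k dvd pderiv g} = {}"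
    unfolding order_divides using assms by auto
  show ?thesis unfolding common_order_def none ord by simp
qed

text \<open>For each root exactly one of \<open>order x g\<close> and \<open>order x g - 1\<close>
  is odd, so the two odd counts add up to the number of distinct roots. That number is the index of
  \<open>g' / g\<close>, which inversion turns into 1 minus the index of
  \<open>g / g'\<close>.\<close>

lemma odd_roots_0_pderiv:
  assumes "degree g \<ge> 1"
  shows "real (odd_roots 0 g) = 1 - cauchy_index g (pderiv g) - real (odd_roots g (pderiv g))"
proof -
  have g: "g \<noteq> 0" and g': "pderiv g \<noteq> 0"
    using assms by (auto simp: pderiv_eq_0_iff)
  have fin: "finite {x. poly g x = 0}" using g by (rule poly_roots_finite)
  have "{x. poly g x = 0} = {x. odd (order x g)} \<union> {x. odd (order x g - 1)}"
    using g by (auto simp: order_root) presburger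
  moreover have "{x. odd (order x g)} \<inter> {x. odd (order x g - 1)} = {}" by auto
  ultimately have "card {x. poly g x = 0} = odd_roots 0 g + odd_roots g (pderiv g)"
    unfolding odd_roots_def common_order_0[OF g] common_order_pderiv[OF g]
    using fin by (metis card_Un_disjoint finite_Un)
  moreover have "cauchy_index (pderiv g) g = degree_crossing (pderiv g * g) - cauchy_index g (pderiv g)"
    by (rule cauchy_index_inversion[OF g' g])
  moreover have "degree_crossing (pderiv g * g) = 1"
  proof -
    have "lead_coeff (pderiv g) = of_nat (degree g) * lead_coeff g"
      using assms by (simp add: degree_pderiv coeff_pderiv)
    then have "sgn (lead_coeff (pderiv g)) = sgn (lead_coeff g)"
      using assms by (simp add: sgn_mult)
    then have "sgn (lead_coeff (pderiv g)) * sgn (lead_coeff g) = 1"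
      using g by (cases "lead_coeff g > 0") auto
    moreover have "odd (degree (pderiv g * g))"
      using assms g g' by (simp add: degree_mult_eq degree_pderiv)
    ultimately show ?thesis
      by (simp add: degree_crossing_def lead_coeff_mult sgn_mult)
  qed
  ultimately show ?thesis using cauchy_index_pderiv[OF g] by simp
qed

lemma odd_roots_0_const:
  assumes "degree g = 0" "g \<noteq> 0"
  shows "odd_roots 0 g = 0"
proof -
  have "order x g = 0" for x using order_degree[OF assms(2), of x] assms(1) by simp
  then show ?thesis unfolding odd_roots_def common_order_0[OF assms(2)] by simp
qed

section \<open>Nonnegativity and even multiplicities\<close>

lemma nonneg_if_even_orders:
  fixes p :: "real poly"
  assumes "lead_coeff p > 0" "\<And>x. even (order x p)"
  shows "poly p y \<ge> 0"
  using assms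
proof (induction "degree p" arbitrary: p rule: less_induct)
  case less
  have p0: "p \<noteq> 0" using less.prems by auto
  show ?case
  proof (cases "\<exists>a. poly p a = 0")
    case True
    then obtain a where a: "poly p a = 0" ..
    define k where "k = order a p"
    obtain q where q: "p = [:-a, 1:] ^ k * q" "poly q a \<noteq> 0"
      using order_lowest_decomp[OF p0] unfolding k_def by metis
    have k: "k \<noteq> 0" "even k" using a p0 less.prems unfolding k_def by (auto simp: order_root)
    have q0: "q \<noteq> 0" using q(2) by auto
    have deg: "degree p = k + degree q"
      unfolding q(1) using q0 by (simp add: degree_mult_eq degree_linear_power)
    have lc: "lead_coeff p = lead_coeff q"
      unfolding q(1) by (simp add: lead_coeff_mult lead_coeff_power)
    \<comment> \<open>Removing the whole power of \<open>X - a\<close> makes the order at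
      \<open>a\<close> zero and changes no other order, so the induction hypothesis applies to
      \<open>q\<close>.\<close>
    have "even (order x q)" for x
    proof (cases "x = a")
      case True
      then show ?thesis using order_0I[OF q(2)] by simp
    next
      case False
      have "order x p = order x ([:-a, 1:] ^ k) + order x q"
        unfolding q(1) using q0 by (intro order_mult) simp
      moreover have "order x ([:-a, 1:] ^ k) = 0" using False by (intro order_0I) simp
      ultimately show ?thesis using less.prems(2)[of x] by simp
    qed
    then have "poly q y \<ge> 0" using less.hyps[of q] deg k lc less.prems by simp
    then show ?thesis unfolding q(1) using k by (simp add: zero_le_even_power)
  next
    case False
    then have "sgn (poly p y) = sgn (lead_coeff p)" by (intro sgn_poly_no_roots_ge) auto
    then show ?thesis using less.prems(1) by (simp add: sgn_1_pos)
  qed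
qed

text \<open>If the order were odd, the cofactor \<open>q\<close> would be nonnegative to the right
  of \<open>x\<close> and nonpositive to the left, forcing \<open>q(x) = 0\<close> by
  continuity.\<close>

lemma even_order_if_nonneg:
  fixes p :: "real poly"
  assumes "p \<noteq> 0" "\<And>y. poly p y \<ge> 0"
  shows "even (order x p)"
proof (rule ccontr)
  assume odd: "odd (order x p)"
  obtain q where q: "p = [:-x, 1:] ^ order x p * q" "poly q x \<noteq> 0"
    using order_lowest_decomp[OF assms(1)] by metis
  have v: "(y - x) ^ order x p * poly q y \<ge> 0" for y
    using assms(2)[of y] by (subst (asm) q(1)) simp
  have r: "poly q y \<ge> 0" if "y > x" for y
  proof -
    have "(y - x) ^ order x p > 0" using that by simp
    with v[of y] show ?thesis by (simp add: zero_le_mult_iff)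
  qed
  have l: "poly q y \<le> 0" if "y < x" for y
  proof -
    have "(y - x) ^ order x p < 0" using that odd by (simp add: power_less_zero_eq)
    with v[of y] show ?thesis by (simp add: zero_le_mult_iff)
  qed
  have c: "(poly q \<longlongrightarrow> poly q x) (at x within S)" for S
    by (rule tendsto_mono[OF at_le[OF subset_UNIV]]) (use poly_isCont isCont_def in blast)
  have "poly q x \<ge> 0"
    by (rule tendsto_lowerbound[OF c[of "{x<..}"]]) (auto simp: eventually_at_filter r)
  moreover have "poly q x \<le> 0"
    by (rule tendsto_upperbound[OF c[of "{..<x}"]]) (auto simp: eventually_at_filter l)
  ultimately show False using q(2) by simp
qed

theorem nonneg_iff_odd_roots:
  assumes "lead_coeff p > 0"
  shows "(\<forall>x. poly p x \<ge> 0) \<longleftrightarrow> odd_roots 0 p = 0"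
proof -
  have p0: "p \<noteq> 0" using assms by auto
  \<comment> \<open>Finiteness has to be established first, since \<open>card\<close> is 0 for
    infinite sets as well.\<close>
  have "poly p x = 0" if "odd (order x p)" for x
    using that order_0I[of p x] by (cases "poly p x = 0") simp_all
  then have "{x. odd (order x p)} \<subseteq> {x. poly p x = 0}" by blast
  then have "finite {x. odd (order x p)}"
    using poly_roots_finite[OF p0] by (rule finite_subset)
  then have odd: "odd_roots 0 p = 0 \<longleftrightarrow> (\<forall>x. even (order x p))"
    unfolding odd_roots_def common_order_0[OF p0] by (simp only: card_0_eq) simp
  show ?thesis
  proof
    assume "\<forall>x. poly p x \<ge> 0"
    then show "odd_roots 0 p = 0" unfolding odd using even_order_if_nonneg[OF p0] by simp
  next
    assume "odd_roots 0 p = 0"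
    then show "\<forall>x. poly p x \<ge> 0" unfolding odd using nonneg_if_even_orders[OF assms] by simp
  qed
qed

section \<open>The state of the computation\<close>

text \<open>\<open>P - Q\<close> accumulates the contributions of the Euclidean steps done so far, while the parity of
  \<open>e\<close> records the sign with which the common odd roots of the current pair still enter.\<close>

definition tracks :: "real poly \<Rightarrow> nat \<Rightarrow> nat \<Rightarrow> nat \<Rightarrow> real poly \<Rightarrow> real poly \<Rightarrow> bool" where
  "tracks p P Q e f g \<longleftrightarrow>
     real (odd_roots 0 p) = \<bar>real P - real Q + cauchy_index f g - (-1) ^ e * real (odd_roots f g)\<bar>"

text \<open>The pair \<open>(0, p)\<close> has index 0, so only the full count remains, with a minus
  sign that the absolute value absorbs.\<close>

lemma tracks_init: "tracks p 0 0 0 0 p"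
  by (simp add: tracks_def)

lemma tracks_add_mult: "g \<noteq> 0 \<Longrightarrow> tracks p P Q e (f + s * g) g \<longleftrightarrow> tracks p P Q e f g"
  by (simp add: tracks_def cauchy_index_add_mult odd_roots_add_mult)

text \<open>Inversion puts a minus sign before the new index. Negating the whole expression inside
  the absolute value restores the plus sign, at the price of exchanging \<open>P\<close> and
  \<open>Q\<close> and flipping \<open>e\<close>.\<close>

lemma tracks_swap:
  assumes "tracks p P Q e f g" "f \<noteq> 0" "g \<noteq> 0" "e \<le> 1"
    and "degree_crossing (f * g) = real j - real k"
  shows "tracks p (Q + k) (P + j) (1 - e) g f"
proof -
  have "e = 0 \<or> e = 1" using assms(4) by linarith
  then show ?thesis
    using assms(1,5) cauchy_index_inversion[OF assms(2,3)] odd_roots_commute[of f g]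
    by (auto simp: tracks_def)
qed

text \<open>Only the term with \<open>odd_roots 0 g\<close> is left, and
  \<open>odd_roots_0_pderiv\<close> rewrites it. For \<open>e = 1\<close> the expression is also
  negated, so that the index enters with a plus sign and the new \<open>e\<close> is 1 in both
  cases.\<close>

lemma tracks_restart:
  assumes "tracks p P Q e 0 g" "degree g \<ge> 1" "e \<le> 1"
  shows "if e = 1 then tracks p Q (P + 1) 1 g (pderiv g) else tracks p P (Q + 1) 1 g (pderiv g)"
proof -
  have "e = 0 \<or> e = 1" using assms(3) by linarith
  then show ?thesis
    using assms(1) odd_roots_0_pderiv[OF assms(2)] by (auto simp: tracks_def)
qed

lemma tracks_const:
  assumes "tracks p P Q e 0 g" "degree g = 0" "g \<noteq> 0"
  shows "odd_roots 0 p = 0 \<longleftrightarrow> P = Q"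
  using assms(1) odd_roots_0_const[OF assms(2,3)] by (auto simp: tracks_def)

section \<open>Polynomials stored as array segments\<close>

definition row :: "(nat \<Rightarrow> real) \<Rightarrow> nat \<Rightarrow> nat \<Rightarrow> real poly" where
  "row r u a = (\<Sum>i<a. monom (r (u + i)) i)"

lemma coeff_row: "coeff (row r u a) i = (if i < a then r (u + i) else 0)"
  unfolding row_def coeff_sum by (simp add: sum.delta[of "{..<a}"])

lemma row_0 [simp]: "row r u 0 = 0"
  by (simp add: row_def)

lemma row_cong: "(\<And>i. i < a \<Longrightarrow> r (u + i) = r' (u + i)) \<Longrightarrow> row r u a = row r' u a"
  by (simp add: row_def)

lemma row_trim:
  assumes "a > 0" "r (u + a - 1) = 0"
  shows "row r u (a - 1) = row r u a"
proof -
  obtain k where "a = Suc k" using assms(1) gr0_implies_Suc by blast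
  with assms(2) show ?thesis by (simp add: row_def)
qed

lemma lead_row:
  assumes "a > 0" "r (u + a - 1) \<noteq> 0"
  shows "degree (row r u a) = a - 1" "lead_coeff (row r u a) = r (u + a - 1)" "row r u a \<noteq> 0"
proof -
  have c: "coeff (row r u a) (a - 1) = r (u + a - 1)" using assms(1) by (simp add: coeff_row)
  show d: "degree (row r u a) = a - 1"
    using assms c by (intro antisym degree_le le_degree) (auto simp: coeff_row)
  show "lead_coeff (row r u a) = r (u + a - 1)" unfolding d c ..
  show "row r u a \<noteq> 0" using c assms(2) by auto
qed

lemma degree_crossing_rows:
  assumes "a > 0" "r (u + a - 1) \<noteq> 0" "b > 0" "r (v + b - 1) \<noteq> 0"
  shows "degree_crossing (row r u a * row r v b) =
    (if odd (a + b) then sgn (r (u + a - 1) * r (v + b - 1)) else 0)"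
proof -
  note l = lead_row[of a r u, OF assms(1,2)] lead_row[of b r v, OF assms(3,4)]
  have "odd ((a - 1) + (b - 1)) \<longleftrightarrow> odd (a + b)" using assms(1,3) by auto
  then show ?thesis
    unfolding degree_crossing_def lead_coeff_mult l(2,5)
    unfolding degree_mult_eq[OF l(3,6)] l(1,4) by simp
qed

text \<open>One step of long division in place: a multiple of \<open>X^(a-b) * g\<close> cancels the
  top coefficient of \<open>f\<close>, so \<open>f\<close> changes only by a multiple of
  \<open>g\<close>.\<close>

lemma row_elimination:
  assumes "0 < b" "b \<le> a" "r (v + b - 1) \<noteq> 0"
    and "\<And>j. j < b \<Longrightarrow> r' (u + (a - b) + j) =
      r (u + (a - b) + j) - r (u + a - 1) / r (v + b - 1) * r (v + j)"
    and "\<And>j. j < a - b \<Longrightarrow> r' (u + j) = r (u + j)"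
  shows "r' (u + a - 1) = 0"
    and "row r' u a = row r u a + - monom (r (u + a - 1) / r (v + b - 1)) (a - b) * row r v b"
proof -
  define h where "h = r (u + a - 1) / r (v + b - 1)"
  show "r' (u + a - 1) = 0" using assms(1,2,3) assms(4)[of "b - 1"] by simp
  show "row r' u a = row r u a + - monom (r (u + a - 1) / r (v + b - 1)) (a - b) * row r v b"
    unfolding h_def[symmetric]
  proof (rule poly_eqI)
    fix i
    show "coeff (row r' u a) i = coeff (row r u a + - monom h (a - b) * row r v b) i"
      using assms(2) assms(4)[of "i - (a - b)"] assms(5)[of i]
      unfolding coeff_add mult_minus_left coeff_minus coeff_monom_mult coeff_row h_def[symmetric]
      by auto
  qed
qed

lemma row_pderiv:
  assumes "0 < b" "\<And>j. j < b - 1 \<Longrightarrow> r' (u + j) = real (Suc j) * r (v + Suc j)"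
  shows "row r' u (b - 1) = pderiv (row r v b)"
  by (rule poly_eqI) (use assms in \<open>auto simp: coeff_row coeff_pderiv simp del: of_nat_Suc\<close>)

section \<open>Total correctness with costs\<close>

text \<open>Asking for one good run suffices because execution is deterministic.\<close>

definition wp :: "com \<Rightarrow> state \<Rightarrow> (nat \<Rightarrow> state \<Rightarrow> bool) \<Rightarrow> bool" where
  "wp c s R \<longleftrightarrow> (\<exists>n t. exec c s n t \<and> R n t)"

lemma wp_Skip: "R 0 s \<Longrightarrow> wp Skip s R"
  and wp_NAssign: "R 0 (nupdate x (nval a s) s) \<Longrightarrow> wp (NAssign x a) s R"
  and wp_RConst: "R 0 (rupdate l (of_rat q) s) \<Longrightarrow> wp (RConst l q) s R"
  and wp_ROp: "f = Div \<longrightarrow> rval m' s \<noteq> 0 \<Longrightarrow>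
    R 1 (rupdate l (arith_val f (rval m s) (rval m' s)) s) \<Longrightarrow> wp (ROp f l m m') s R"
  unfolding wp_def by (blast intro: exec.intros)+

lemma wp_Seq: "wp c s (\<lambda>n s'. wp c' s' (\<lambda>n' t. R (n + n') t)) \<Longrightarrow> wp (Seq c c') s R"
  unfolding wp_def by (blast intro: exec.intros)

lemma wp_If:
  assumes "bval b s \<Longrightarrow> wp c s (\<lambda>n t. R (bcost b + n) t)"
    and "\<not> bval b s \<Longrightarrow> wp c' s (\<lambda>n t. R (bcost b + n) t)"
  shows "wp (If b c c') s R"
  using assms unfolding wp_def by (cases "bval b s") (blast intro: exec.intros)+

lemmas wp_intros = wp_Skip wp_NAssign wp_RConst wp_ROp wp_Seq wp_If

text \<open>For counting loops with an exact cost \<open>l\<close> per round; the guard compares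
  naturals only and is therefore free.\<close>

lemma wp_for:
  assumes "\<And>k s. k < m \<Longrightarrow> I k s \<Longrightarrow> bval b s \<and> wp c s (\<lambda>n t. n = l \<and> I (Suc k) t)"
    and "\<And>s. I m s \<Longrightarrow> \<not> bval b s" "bcost b = 0" "I 0 s"
    and "\<And>t. I m t \<Longrightarrow> R (m * l) t"
  shows "wp (While b c) s R"
proof -
  have "\<exists>t. exec (While b c) s ((m - k) * l) t \<and> I m t" if "I k s" "k \<le> m" for k s
    using that
  proof (induction "m - k" arbitrary: k s)
    case 0
    then have "I m s" by simp
    with assms(2)[OF this] have stop: "exec (While b c) s 0 s"
      using exec.WhileFalse[of b s c] assms(3) by simp
    have z: "(m - k) * l = 0" using 0 by simp
    show ?case unfolding z using stop \<open>I m s\<close> by blast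
  next
    case (Suc j)
    then have "k < m" by simp
    from assms(1)[OF this Suc.prems(1)]
    obtain s' where s': "bval b s" "exec c s l s'" "I (Suc k) s'"
      unfolding wp_def by blast
    have "j = m - Suc k" "Suc k \<le> m" using Suc.hyps(2) by simp_all
    from Suc.hyps(1)[OF this(1) s'(3) this(2)]
    obtain t where t: "exec (While b c) s' ((m - Suc k) * l) t" "I m t" by blast
    have "m - k = Suc (m - Suc k)" using Suc.hyps(2) by simp
    then have "exec (While b c) s ((m - k) * l) t"
      using exec.WhileTrue[OF s'(1,2) t(1)] assms(3) by simp
    with t(2) show ?case by blast
  qed
  from this[OF assms(4) le0] show ?thesis using assms(5) unfolding wp_def diff_zero by blast
qed

text \<open>The potential bounds the cost and also proves termination. The strict decrease is a
  separate demand because a round may cost nothing.\<close>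

lemma wp_while_potential:
  fixes pot :: "state \<Rightarrow> nat"
  assumes "\<And>s. I s \<Longrightarrow> bval b s \<Longrightarrow> wp c s (\<lambda>n t. I t \<and> n + pot t \<le> pot s \<and> pot t < pot s)"
    and "bcost b = 0" "I s" "\<And>n t. I t \<Longrightarrow> \<not> bval b t \<Longrightarrow> n \<le> pot s \<Longrightarrow> R n t"
  shows "wp (While b c) s R"
proof -
  have "\<exists>n t. exec (While b c) s n t \<and> I t \<and> \<not> bval b t \<and> n \<le> pot s" if "I s" for s
    using that
  proof (induction "pot s" arbitrary: s rule: less_induct)
    case less
    show ?case
    proof (cases "bval b s")
      case False
      then have "exec (While b c) s 0 s" using exec.WhileFalse[of b s c] assms(2) by simp
      then show ?thesis using False less.prems by blast
    next
      case True
      then obtain n s' where s': "exec c s n s'" "I s'" "n + pot s' \<le> pot s" "pot s' < pot s"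
        using assms(1)[OF less.prems] unfolding wp_def by blast
      obtain n' t where t: "exec (While b c) s' n' t" "I t" "\<not> bval b t" "n' \<le> pot s'"
        using less.hyps[OF s'(4,2)] by blast
      have "bcost b + n + n' \<le> pot s" using assms(2) s'(3) t(4) by simp
      then show ?thesis using exec.WhileTrue[OF True s'(1) t(1)] t by blast
    qed
  qed
  from this[OF assms(3)] show ?thesis using assms(4) unfolding wp_def by blast
qed

section \<open>The program\<close>

abbreviation seq (infixr \<open>;;\<close> 60) where "c ;; c' \<equiv> Seq c c'"

definition exchange :: "name \<Rightarrow> name \<Rightarrow> com" where
  "exchange x y = NAssign ''t'' (V x) ;; NAssign x (V y) ;; NAssign y (V ''t'')"

definition increment :: "name \<Rightarrow> com" where
  "increment x = NAssign x (Plus (V x) (N 1))"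

definition lead :: "name \<Rightarrow> name \<Rightarrow> loc" where
  "lead u a = Cell ''p'' (Minus (Plus (V u) (V a)) (N 1))"

text \<open>
  The current pair \<open>(f, g)\<close> of polynomials lies in array \<open>p\<close>: \<open>a\<close> coefficients of \<open>f\<close> at offset \<open>u\<close> and
  \<open>b\<close> coefficients of \<open>g\<close> at offset \<open>v\<close>. Register \<open>c\<close> holds the parity of \<open>a + b\<close> whenever \<open>a > 0\<close>,
  and \<open>P\<close>, \<open>Q\<close>, \<open>e\<close> are as in \<^const>\<open>tracks\<close>. Array \<open>z\<close> is never written, so it supplies the constant \<open>0\<close>.
\<close>

definition drop_zero :: com where
  "drop_zero = NAssign ''a'' (Minus (V ''a'') (N 1)) ;; NAssign ''c'' (Minus (N 1) (V ''c''))"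

definition reciprocity_relabel :: com where
  "reciprocity_relabel =
     exchange ''P'' ''Q'' ;; exchange ''a'' ''b'' ;; exchange ''u'' ''v'' ;;
     NAssign ''e'' (Minus (N 1) (V ''e''))"

text \<open>This realizes \<open>tracks_swap\<close>. The product of the two polynomials has degree
  \<open>a + b - 2\<close>, so only odd \<open>a + b\<close> contributes, with the sign of the
  product of the leading coefficients. The increment precedes the exchange, so a positive sign ends
  up in \<open>Q\<close>.\<close>

definition reciprocity :: com where
  "reciprocity =
     ROp Mul (Cell ''w'' (N 0)) (lead ''u'' ''a'') (lead ''v'' ''b'') ;;
     If (NLess (N 0) (V ''c''))
       (If (RLess (Cell ''z'' (N 0)) (Cell ''w'' (N 0))) (increment ''P'') (increment ''Q''))
       Skip ;;
     reciprocity_relabel"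

definition eliminate_body :: com where
  "eliminate_body =
     ROp Mul (Cell ''w'' (N 0)) (Cell ''r'' (N 0)) (Cell ''p'' (Plus (V ''v'') (V ''i''))) ;;
     ROp Sub (Cell ''p'' (Plus (Plus (V ''u'') (Minus (V ''a'') (V ''b''))) (V ''i'')))
       (Cell ''p'' (Plus (Plus (V ''u'') (Minus (V ''a'') (V ''b''))) (V ''i''))) (Cell ''w'' (N 0)) ;;
     increment ''i''"

definition eliminate :: com where
  "eliminate =
     ROp Div (Cell ''r'' (N 0)) (lead ''u'' ''a'') (lead ''v'' ''b'') ;;
     NAssign ''i'' (N 0) ;;
     While (NLess (V ''i'') (V ''b'')) eliminate_body ;;
     drop_zero"

text \<open>The factor \<open>i + 1\<close> of the derivative is counted in a real cell, since
  naturals cannot be converted to reals.\<close>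

definition restart_body :: com where
  "restart_body =
     ROp Add (Cell ''k'' (N 0)) (Cell ''k'' (N 0)) (Cell ''one'' (N 0)) ;;
     ROp Mul (Cell ''p'' (Plus (V ''u'') (V ''i''))) (Cell ''k'' (N 0))
       (Cell ''p'' (Plus (V ''v'') (Plus (V ''i'') (N 1)))) ;;
     increment ''i''"

text \<open>The derivative has been written over the exhausted row at \<open>u\<close>; it becomes
  the new \<open>g\<close> and the old \<open>g\<close> the new \<open>f\<close>. The sizes
  \<open>b\<close> and \<open>b - 1\<close> have odd sum, hence \<open>c = 1\<close>.\<close>

definition restart_relabel :: com where
  "restart_relabel =
     exchange ''u'' ''v'' ;;
     NAssign ''a'' (V ''b'') ;; NAssign ''b'' (Minus (V ''b'') (N 1)) ;; NAssign ''c'' (N 1) ;;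
     If (NLess (N 0) (V ''e'')) (exchange ''P'' ''Q'') Skip ;;
     increment ''Q'' ;; NAssign ''e'' (N 1)"

definition restart :: com where
  "restart =
     RConst (Cell ''k'' (N 0)) 0 ;;
     NAssign ''i'' (N 0) ;;
     While (NLess (Plus (V ''i'') (N 1)) (V ''b'')) restart_body ;;
     restart_relabel"

definition step :: com where
  "step =
     If (NLess (N 0) (V ''a''))
       (If (REq (lead ''u'' ''a'') (Cell ''z'' (N 0))) drop_zero
         (If (NLess (V ''a'') (V ''b'')) reciprocity eliminate))
       restart"

text \<open>With truncated subtraction the inner sum is the distance of \<open>P\<close> and
  \<open>Q\<close>, so the result is 1 if they agree and 0 otherwise.\<close>

definition verdict :: com where
  "verdict = NAssign ''result''
     (Minus (N 1) (Plus (Minus (V ''P'') (V ''Q'')) (Minus (V ''Q'') (V ''P''))))"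

text \<open>The initial pair is \<open>(0, p)\<close>, with \<open>a = 0\<close>, so the first step
  is a restart.\<close>

definition nonneg_test :: com where
  "nonneg_test =
     RConst (Cell ''one'' (N 0)) 1 ;;
     NAssign ''u'' (Plus (V ''d'') (N 1)) ;; NAssign ''b'' (Plus (V ''d'') (N 1)) ;;
     While (NLess (N 1) (Plus (V ''a'') (V ''b''))) step ;;
     verdict"

text \<open>The rows stay in disjoint blocks of \<open>D\<close> cells. The top coefficient of
  \<open>g\<close> is nonzero, while that of \<open>f\<close> may vanish until it is trimmed. The
  parity clause is conditional because \<open>c\<close> is set only by the first restart.\<close>

fun invariant :: "real poly \<Rightarrow> nat \<Rightarrow> state \<Rightarrow> bool" where
  "invariant p D (\<nu>, \<rho>) \<longleftrightarrow>
     (\<nu> ''u'' = 0 \<and> \<nu> ''v'' = D \<or> \<nu> ''u'' = D \<and> \<nu> ''v'' = 0) \<and>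
     \<nu> ''a'' \<le> D \<and> \<nu> ''b'' \<le> D \<and> 0 < \<nu> ''b'' \<and> \<rho> ''p'' (\<nu> ''v'' + \<nu> ''b'' - 1) \<noteq> 0 \<and>
     \<rho> ''z'' 0 = 0 \<and> \<rho> ''one'' 0 = 1 \<and> \<nu> ''e'' \<le> 1 \<and>
     (0 < \<nu> ''a'' \<longrightarrow> \<nu> ''c'' = (\<nu> ''a'' + \<nu> ''b'') mod 2) \<and>
     tracks p (\<nu> ''P'') (\<nu> ''Q'') (\<nu> ''e'')
       (row (\<rho> ''p'') (\<nu> ''u'') (\<nu> ''a'')) (row (\<rho> ''p'') (\<nu> ''v'') (\<nu> ''b''))"

text \<open>Each unit of the last summand pays for one elimination step and the second summand for tests of
  leading coefficients that vanish. A division step between sizes \<open>b\<close> and \<open>a < b\<close> takes \<open>b - a + 1\<close>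
  eliminations, which the drop of the first summand covers.\<close>

definition potential :: "nat \<Rightarrow> nat \<Rightarrow> nat \<Rightarrow> nat" where
  "potential D a b = 4 * (2 * D + 2) * b + min a (b - 1) + (2 * D + 2) * (a + 1 - b)"

section \<open>Decrease of the potential\<close>

lemma potential_drop_zero:
  assumes "0 < a" "0 < b"
  shows "1 + potential D (a - 1) b \<le> potential D a b"
proof (cases "a < b")
  case True
  then show ?thesis using assms by (simp add: potential_def)
next
  case False
  then have e: "a + 1 - b = Suc (a - 1 + 1 - b)" using assms(1) by simp
  show ?thesis unfolding potential_def e mult_Suc_right by simp
qed

lemma potential_eliminate:
  assumes "0 < b" "b \<le> a"
  shows "2 * D + 2 + potential D (a - 1) b \<le> potential D a b"
proof -
  have e: "a + 1 - b = Suc (a - 1 + 1 - b)" using assms by simp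
  have "min (a - 1) (b - 1) \<le> min a (b - 1)" by simp
  then show ?thesis unfolding potential_def e mult_Suc_right by linarith
qed

text \<open>With \<open>b = a + k + 1\<close>, the first summand releases \<open>4 * (k + 1)\<close>
  units of \<open>2 * D + 2\<close>, more than the \<open>k + 2\<close> units that the coming
  eliminations need.\<close>

lemma potential_reciprocity:
  assumes "0 < a" "a < b"
  shows "3 + potential D b a \<le> potential D a b"
proof -
  obtain k where k: "b = Suc (a + k)" using assms(2) less_iff_Suc_add by auto
  show ?thesis using assms(1) unfolding potential_def k by (simp add: algebra_simps)
qed

lemma potential_restart:
  assumes "1 < b" "b \<le> D"
  shows "2 * (b - 1) + potential D b (b - 1) \<le> potential D 0 b"
proof -
  obtain k where k: "b = Suc (Suc k)" using assms(1) less_iff_Suc_add by auto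
  show ?thesis using assms(2) unfolding potential_def k by (simp add: algebra_simps)
qed

section \<open>Verification of the two inner loops\<close>

lemma wp_eliminate_loop:
  assumes "\<nu> ''b'' \<le> \<nu> ''a''" "\<nu> ''u'' + \<nu> ''a'' \<le> \<nu> ''v'' \<or> \<nu> ''v'' + \<nu> ''b'' \<le> \<nu> ''u''"
    and "\<nu> ''i'' = 0"
    and "\<And>\<rho>'. (\<And>x. x \<noteq> ''p'' \<Longrightarrow> x \<noteq> ''w'' \<Longrightarrow> \<rho>' x = \<rho> x) \<Longrightarrow>
      (\<And>j. \<rho>' ''p'' j = (if \<nu> ''u'' + (\<nu> ''a'' - \<nu> ''b'') \<le> j \<and> j < \<nu> ''u'' + \<nu> ''a''
        then \<rho> ''p'' j - \<rho> ''r'' 0 * \<rho> ''p'' (\<nu> ''v'' + (j - (\<nu> ''u'' + (\<nu> ''a'' - \<nu> ''b''))))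
        else \<rho> ''p'' j)) \<Longrightarrow> R (\<nu> ''b'' * 2) (\<nu>(''i'' := \<nu> ''b''), \<rho>')"
  shows "wp (While (NLess (V ''i'') (V ''b'')) eliminate_body) (\<nu>, \<rho>) R"
proof -
  define w where "w = \<nu> ''u'' + (\<nu> ''a'' - \<nu> ''b'')"
  define I where "I k s \<longleftrightarrow> (\<exists>\<rho>'. s = (\<nu>(''i'' := k), \<rho>') \<and>
      (\<forall>x. x \<noteq> ''p'' \<longrightarrow> x \<noteq> ''w'' \<longrightarrow> \<rho>' x = \<rho> x) \<and>
      (\<forall>j. \<rho>' ''p'' j = (if w \<le> j \<and> j < w + k
        then \<rho> ''p'' j - \<rho> ''r'' 0 * \<rho> ''p'' (\<nu> ''v'' + (j - w)) else \<rho> ''p'' j)))"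
    for k and s :: state
  have w: "w + \<nu> ''b'' = \<nu> ''u'' + \<nu> ''a''" using assms(1) by (simp add: w_def)
  show ?thesis
  proof (rule wp_for[where I = I and m = "\<nu> ''b''" and l = 2])
    fix k s assume k: "k < \<nu> ''b''" and "I k s"
    then obtain \<rho>' where s: "s = (\<nu>(''i'' := k), \<rho>')"
      and other: "\<And>x. x \<noteq> ''p'' \<Longrightarrow> x \<noteq> ''w'' \<Longrightarrow> \<rho>' x = \<rho> x"
      and p: "\<And>j. \<rho>' ''p'' j = (if w \<le> j \<and> j < w + k
        then \<rho> ''p'' j - \<rho> ''r'' 0 * \<rho> ''p'' (\<nu> ''v'' + (j - w)) else \<rho> ''p'' j)"
      unfolding I_def by blast
    \<comment> \<open>The rows do not overlap, so the divisor row is still intact when it is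
      read.\<close>
    have read: "\<rho>' ''p'' (\<nu> ''v'' + k) = \<rho> ''p'' (\<nu> ''v'' + k)"
      using assms(1,2) k w unfolding p by (auto simp: w_def)
    have top: "\<rho>' ''p'' (w + k) = \<rho> ''p'' (w + k)" by (simp add: p)
    have r0: "\<rho>' ''r'' = \<rho> ''r''" by (rule other) simp_all
    have step: "I (Suc k) (\<nu>(''i'' := Suc k), \<rho>'(''w'' := x, ''p'' := (\<rho>' ''p'')
        (w + k := \<rho>' ''p'' (w + k) - \<rho>' ''r'' 0 * \<rho>' ''p'' (\<nu> ''v'' + k))))" (is "I _ (_, ?r)") for x
      unfolding I_def
    proof (rule exI[of _ ?r], intro conjI allI impI)
      fix j
      show "?r ''p'' j =
        (if w \<le> j \<and> j < w + Suc k
          then \<rho> ''p'' j - \<rho> ''r'' 0 * \<rho> ''p'' (\<nu> ''v'' + (j - w)) else \<rho> ''p'' j)"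
      proof (cases "j = w + k")
        case True
        then show ?thesis by (simp add: top read r0)
      next
        case False
        then have "j < w + Suc k \<longleftrightarrow> j < w + k" by auto
        with False show ?thesis by (simp add: p[of j])
      qed
    qed (simp_all add: other)
    show "bval (NLess (V ''i'') (V ''b'')) s \<and> wp eliminate_body s (\<lambda>n t. n = 2 \<and> I (Suc k) t)"
    proof
      show "wp eliminate_body s (\<lambda>n t. n = 2 \<and> I (Suc k) t)"
        unfolding s eliminate_body_def increment_def
        by (intro wp_intros) (simp_all add: w_def[symmetric] step)
    qed (simp add: s k)
  next
    show "I 0 (\<nu>, \<rho>)"
      unfolding I_def by (rule exI[of _ \<rho>]) (simp add: fun_upd_idem[of \<nu>, OF assms(3)])
  next
    fix t assume "I (\<nu> ''b'') t"
    then obtain \<rho>' where t: "t = (\<nu>(''i'' := \<nu> ''b''), \<rho>')"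
      and other: "\<And>x. x \<noteq> ''p'' \<Longrightarrow> x \<noteq> ''w'' \<Longrightarrow> \<rho>' x = \<rho> x"
      and p: "\<And>j. \<rho>' ''p'' j = (if w \<le> j \<and> j < \<nu> ''u'' + \<nu> ''a''
        then \<rho> ''p'' j - \<rho> ''r'' 0 * \<rho> ''p'' (\<nu> ''v'' + (j - w)) else \<rho> ''p'' j)"
      unfolding I_def w by blast
    show "R (\<nu> ''b'' * 2) t" unfolding t
      by (rule assms(4)) (simp_all add: other p w_def)
  next
    fix s assume "I (\<nu> ''b'') s"
    then obtain \<rho>' where "s = (\<nu>(''i'' := \<nu> ''b''), \<rho>')" unfolding I_def by blast
    then show "\<not> bval (NLess (V ''i'') (V ''b'')) s" by simp
  qed simp
qed

lemma wp_restart_loop: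
  assumes "\<nu> ''u'' + \<nu> ''b'' \<le> \<nu> ''v'' + 1 \<or> \<nu> ''v'' + \<nu> ''b'' \<le> \<nu> ''u''"
    and "\<nu> ''i'' = 0" "\<rho> ''k'' 0 = 0" "\<rho> ''one'' 0 = 1"
    and "\<And>\<rho>'. (\<And>x. x \<noteq> ''p'' \<Longrightarrow> x \<noteq> ''k'' \<Longrightarrow> \<rho>' x = \<rho> x) \<Longrightarrow>
      (\<And>j. \<rho>' ''p'' j = (if \<nu> ''u'' \<le> j \<and> j < \<nu> ''u'' + (\<nu> ''b'' - 1)
        then real (Suc (j - \<nu> ''u'')) * \<rho> ''p'' (\<nu> ''v'' + Suc (j - \<nu> ''u''))
        else \<rho> ''p'' j)) \<Longrightarrow> R ((\<nu> ''b'' - 1) * 2) (\<nu>(''i'' := \<nu> ''b'' - 1), \<rho>')"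
  shows "wp (While (NLess (Plus (V ''i'') (N 1)) (V ''b'')) restart_body) (\<nu>, \<rho>) R"
proof -
  define I where "I k s \<longleftrightarrow> (\<exists>\<rho>'. s = (\<nu>(''i'' := k), \<rho>') \<and>
      (\<forall>x. x \<noteq> ''p'' \<longrightarrow> x \<noteq> ''k'' \<longrightarrow> \<rho>' x = \<rho> x) \<and> \<rho>' ''k'' 0 = real k \<and>
      (\<forall>j. \<rho>' ''p'' j = (if \<nu> ''u'' \<le> j \<and> j < \<nu> ''u'' + k
        then real (Suc (j - \<nu> ''u'')) * \<rho> ''p'' (\<nu> ''v'' + Suc (j - \<nu> ''u'')) else \<rho> ''p'' j)))"
    for k and s :: state
  show ?thesis
  proof (rule wp_for[where I = I and m = "\<nu> ''b'' - 1" and l = 2])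
    fix k s assume k: "k < \<nu> ''b'' - 1" and "I k s"
    then obtain \<rho>' where s: "s = (\<nu>(''i'' := k), \<rho>')"
      and other: "\<And>x. x \<noteq> ''p'' \<Longrightarrow> x \<noteq> ''k'' \<Longrightarrow> \<rho>' x = \<rho> x"
      and count: "\<rho>' ''k'' 0 = real k"
      and p: "\<And>j. \<rho>' ''p'' j = (if \<nu> ''u'' \<le> j \<and> j < \<nu> ''u'' + k
        then real (Suc (j - \<nu> ''u'')) * \<rho> ''p'' (\<nu> ''v'' + Suc (j - \<nu> ''u'')) else \<rho> ''p'' j)"
      unfolding I_def by blast
    have read: "\<rho>' ''p'' (Suc (\<nu> ''v'' + k)) = \<rho> ''p'' (Suc (\<nu> ''v'' + k))"
      using assms(1) k unfolding p by auto
    have one: "\<rho>' ''one'' 0 = 1" using other[of "''one''"] assms(4) by simp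
    have step: "I (Suc k) (\<nu>(''i'' := Suc k), \<rho>'(''k'' := (\<rho>' ''k'')(0 := real k + 1),
        ''p'' := (\<rho>' ''p'')(\<nu> ''u'' + k := (real k + 1) * \<rho>' ''p'' (Suc (\<nu> ''v'' + k)))))"
      (is "I _ (_, ?r)") unfolding I_def
    proof (rule exI[of _ ?r], intro conjI allI impI)
      fix j
      show "?r ''p'' j =
        (if \<nu> ''u'' \<le> j \<and> j < \<nu> ''u'' + Suc k
          then real (Suc (j - \<nu> ''u'')) * \<rho> ''p'' (\<nu> ''v'' + Suc (j - \<nu> ''u'')) else \<rho> ''p'' j)"
      proof (cases "j = \<nu> ''u'' + k")
        case True
        then show ?thesis by (simp add: read)
      next
        case False
        then have "j < \<nu> ''u'' + Suc k \<longleftrightarrow> j < \<nu> ''u'' + k" by auto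
        with False show ?thesis by (simp add: p[of j])
      qed
    qed (simp_all add: other)
    show "bval (NLess (Plus (V ''i'') (N 1)) (V ''b'')) s \<and>
        wp restart_body s (\<lambda>n t. n = 2 \<and> I (Suc k) t)"
    proof
      show "wp restart_body s (\<lambda>n t. n = 2 \<and> I (Suc k) t)"
        unfolding s restart_body_def increment_def
        by (intro wp_intros) (simp_all add: count one step)
    qed (use k in \<open>simp add: s\<close>)
  next
    show "I 0 (\<nu>, \<rho>)"
      unfolding I_def by (rule exI[of _ \<rho>]) (simp add: fun_upd_idem[of \<nu>, OF assms(2)] assms(3))
  next
    fix t assume "I (\<nu> ''b'' - 1) t"
    then obtain \<rho>' where t: "t = (\<nu>(''i'' := \<nu> ''b'' - 1), \<rho>')"
      and other: "\<And>x. x \<noteq> ''p'' \<Longrightarrow> x \<noteq> ''k'' \<Longrightarrow> \<rho>' x = \<rho> x"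
      and p: "\<And>j. \<rho>' ''p'' j = (if \<nu> ''u'' \<le> j \<and> j < \<nu> ''u'' + (\<nu> ''b'' - 1)
        then real (Suc (j - \<nu> ''u'')) * \<rho> ''p'' (\<nu> ''v'' + Suc (j - \<nu> ''u'')) else \<rho> ''p'' j)"
      unfolding I_def by blast
    show "R ((\<nu> ''b'' - 1) * 2) t" unfolding t
      by (rule assms(5)) (simp_all add: other p)
  next
    fix s assume "I (\<nu> ''b'' - 1) s"
    then obtain \<rho>' where "s = (\<nu>(''i'' := \<nu> ''b'' - 1), \<rho>')" unfolding I_def by blast
    then show "\<not> bval (NLess (Plus (V ''i'') (N 1)) (V ''b'')) s" by simp
  qed simp
qed

section \<open>Verification of the four branches\<close>

lemma parity_pred: "0 < m \<Longrightarrow> 1 - (m + n) mod 2 = (m - 1 + n) mod (2 :: nat)"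
  by (cases m) (auto simp: mod2_eq_if)

lemma wp_drop_zero:
  assumes "invariant p D (\<nu>, \<rho>)" "0 < \<nu> ''a''" "\<rho> ''p'' (\<nu> ''u'' + \<nu> ''a'' - 1) = 0"
    and "\<And>\<nu>'. invariant p D (\<nu>', \<rho>) \<Longrightarrow> \<nu>' ''a'' = \<nu> ''a'' - 1 \<Longrightarrow> \<nu>' ''b'' = \<nu> ''b'' \<Longrightarrow> R 0 (\<nu>', \<rho>)"
  shows "wp drop_zero (\<nu>, \<rho>) R"
proof -
  let ?\<nu> = "\<nu>(''a'' := \<nu> ''a'' - 1, ''c'' := 1 - \<nu> ''c'')"
  have c: "1 - \<nu> ''c'' = (\<nu> ''a'' - 1 + \<nu> ''b'') mod 2"
    using assms(1,2) parity_pred[of "\<nu> ''a''" "\<nu> ''b''"] by simp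
  have bound: "\<nu> ''a'' - 1 \<le> D" using assms(1) by (simp add: le_diff_conv)
  have "invariant p D (?\<nu>, \<rho>)"
    using assms(1) c bound row_trim[of "\<nu> ''a''" "\<rho> ''p''" "\<nu> ''u''", OF assms(2,3)] by simp
  then have "R 0 (?\<nu>, \<rho>)" by (rule assms(4)) simp_all
  then show ?thesis unfolding drop_zero_def by (intro wp_intros) simp
qed

lemma wp_exchange:
  assumes "x \<noteq> ''t''" "y \<noteq> ''t''" "R 0 (\<nu>(''t'' := \<nu> x, x := \<nu> y, y := \<nu> x), \<rho>)"
  shows "wp (exchange x y) (\<nu>, \<rho>) R"
  unfolding exchange_def by (intro wp_Seq wp_NAssign) (use assms in simp)

lemma wp_reciprocity:
  assumes "invariant p D (\<nu>, \<rho>)" "0 < \<nu> ''a''" "\<rho> ''p'' (\<nu> ''u'' + \<nu> ''a'' - 1) \<noteq> 0"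
    and "\<And>n \<nu>' \<rho>'. invariant p D (\<nu>', \<rho>') \<Longrightarrow> \<nu>' ''a'' = \<nu> ''b'' \<Longrightarrow> \<nu>' ''b'' = \<nu> ''a'' \<Longrightarrow>
      n \<le> 2 \<Longrightarrow> R n (\<nu>', \<rho>')"
  shows "wp reciprocity (\<nu>, \<rho>) R"
proof -
  let ?l = "\<rho> ''p'' (\<nu> ''u'' + \<nu> ''a'' - 1) * \<rho> ''p'' (\<nu> ''v'' + \<nu> ''b'' - 1)"
  let ?f = "row (\<rho> ''p'') (\<nu> ''u'') (\<nu> ''a'')" and ?g = "row (\<rho> ''p'') (\<nu> ''v'') (\<nu> ''b'')"
  have b: "0 < \<nu> ''b''" "\<rho> ''p'' (\<nu> ''v'' + \<nu> ''b'' - 1) \<noteq> 0"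
    and z: "\<rho> ''z'' 0 = 0"
    and c: "\<nu> ''c'' = (\<nu> ''a'' + \<nu> ''b'') mod 2" and e: "\<nu> ''e'' \<le> 1"
    and t: "tracks p (\<nu> ''P'') (\<nu> ''Q'') (\<nu> ''e'') ?f ?g"
    using assms(1,2) by auto
  note l = lead_row[of "\<nu> ''a''" "\<rho> ''p''" "\<nu> ''u''", OF assms(2,3)]
    lead_row[of "\<nu> ''b''" "\<rho> ''p''" "\<nu> ''v''", OF b]
  have dc: "degree_crossing (?f * ?g) = (if odd (\<nu> ''a'' + \<nu> ''b'') then sgn ?l else 0)"
    using degree_crossing_rows[of "\<nu> ''a''" "\<rho> ''p''" "\<nu> ''u''", OF assms(2,3) b] .
  have sw: "tracks p (\<nu> ''Q'' + k) (\<nu> ''P'' + j) (1 - \<nu> ''e'') ?g ?f"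
    if "degree_crossing (?f * ?g) = real j - real k" for j k
    using tracks_swap[OF t l(3,6) e that] .
  have dc': "degree_crossing (?f * ?g) = (if 0 < \<nu> ''c'' then sgn ?l else 0)"
    unfolding dc c by (simp add: mod2_eq_if)
  \<comment> \<open>Both leading coefficients are nonzero, so a single comparison with 0 determines
    the sign.\<close>
  have "?l \<noteq> 0" using assms(3) b(2) by simp
  then have s: "0 < ?l \<Longrightarrow> sgn ?l = 1" "\<not> 0 < ?l \<Longrightarrow> sgn ?l = -1"
    by (simp_all only: sgn_pos sgn_neg linorder_not_less order.order_iff_strict) auto
  have pos: "tracks p (\<nu> ''Q'') (\<nu> ''P'' + 1) (1 - \<nu> ''e'') ?g ?f" if "0 < \<nu> ''c''" "0 < ?l"
    using sw[of 1 0] that s(1) by (simp only: dc') simp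
  have neg: "tracks p (\<nu> ''Q'' + 1) (\<nu> ''P'') (1 - \<nu> ''e'') ?g ?f" if "0 < \<nu> ''c''" "\<not> 0 < ?l"
    using sw[of 0 1] that s(2) by (simp only: dc') simp
  have zero: "tracks p (\<nu> ''Q'') (\<nu> ''P'') (1 - \<nu> ''e'') ?g ?f" if "\<not> 0 < \<nu> ''c''"
    using sw[of 0 0] that by (simp only: dc') simp
  \<comment> \<open>\<open>Q\<close> and \<open>P\<close> appear in exchanged places because the
    relabelling swaps them. The cost \<open>k\<close> so far is one multiplication and at most one
    comparison.\<close>
  have relabel: "wp reciprocity_relabel (\<nu>(''P'' := P, ''Q'' := Q), \<rho>(''w'' := x)) (\<lambda>n t. R (k + n) t)"
    if "tracks p Q P (1 - \<nu> ''e'') ?g ?f" "k \<le> 2" for P Q x k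
    unfolding reciprocity_relabel_def
    apply (rule wp_Seq, rule wp_exchange, simp, simp, simp)
    apply (rule wp_Seq, rule wp_exchange, simp, simp, simp)
    apply (rule wp_Seq, rule wp_exchange, simp, simp, simp)
    apply (rule wp_NAssign, simp)
    apply (rule assms(4))
    using assms(1-3) that c by (auto simp: add.commute)
  show ?thesis
    unfolding reciprocity_def increment_def lead_def
    apply (rule wp_Seq, rule wp_ROp, simp)
    apply (rule wp_Seq, rule wp_If)
    subgoal
      apply (rule wp_If)
      subgoal
        apply (rule wp_NAssign)
        using relabel[where P = "\<nu> ''P'' + 1" and Q = "\<nu> ''Q''" and x = "(\<rho> ''w'')(0 := ?l)" and k = 2] pos z by (simp add: fun_upd_idem)
      subgoal
        apply (rule wp_NAssign)
        using relabel[where P = "\<nu> ''P''" and Q = "\<nu> ''Q'' + 1" and x = "(\<rho> ''w'')(0 := ?l)" and k = 2] neg z by (simp add: fun_upd_idem)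
      done
    subgoal
      apply (rule wp_Skip)
      using relabel[where P = "\<nu> ''P''" and Q = "\<nu> ''Q''" and x = "(\<rho> ''w'')(0 := ?l)" and k = 1] zero z by (simp add: fun_upd_idem)
    done
qed

lemma wp_eliminate:
  assumes "invariant p D (\<nu>, \<rho>)" "\<nu> ''b'' \<le> \<nu> ''a''"
    and "\<And>\<nu>' \<rho>'. invariant p D (\<nu>', \<rho>') \<Longrightarrow> \<nu>' ''a'' = \<nu> ''a'' - 1 \<Longrightarrow> \<nu>' ''b'' = \<nu> ''b'' \<Longrightarrow>
      R (Suc (\<nu> ''b'' * 2)) (\<nu>', \<rho>')"
  shows "wp eliminate (\<nu>, \<rho>) R"
proof -
  let ?a = "\<nu> ''a''" and ?b = "\<nu> ''b''" and ?u = "\<nu> ''u''" and ?v = "\<nu> ''v''"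
  define h where "h = \<rho> ''p'' (?u + ?a - 1) / \<rho> ''p'' (?v + ?b - 1)"
  define \<rho>1 where "\<rho>1 = \<rho>(''r'' := (\<rho> ''r'')(0 := h))"
  have b: "0 < ?b" "\<rho> ''p'' (?v + ?b - 1) \<noteq> 0"
    and disjoint: "?u + ?a \<le> ?v \<or> ?v + ?b \<le> ?u"
    and t: "tracks p (\<nu> ''P'') (\<nu> ''Q'') (\<nu> ''e'') (row (\<rho> ''p'') ?u ?a) (row (\<rho> ''p'') ?v ?b)"
    using assms(1) by auto
  have "wp (While (NLess (V ''i'') (V ''b'')) eliminate_body) (\<nu>(''i'' := 0), \<rho>1)
    (\<lambda>n s. wp drop_zero s (\<lambda>n' t. R (1 + (n + n')) t))"
  proof (rule wp_eliminate_loop)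
    fix \<rho>'
    assume "\<And>x. x \<noteq> ''p'' \<Longrightarrow> x \<noteq> ''w'' \<Longrightarrow> \<rho>' x = \<rho>1 x"
    then have other: "\<rho>' ''z'' = \<rho> ''z''" "\<rho>' ''one'' = \<rho> ''one''" by (simp_all add: \<rho>1_def)
    assume "\<And>j. \<rho>' ''p'' j = (if (\<nu>(''i'' := 0)) ''u'' + ((\<nu>(''i'' := 0)) ''a'' - (\<nu>(''i'' := 0)) ''b'') \<le> j \<and>
          j < (\<nu>(''i'' := 0)) ''u'' + (\<nu>(''i'' := 0)) ''a''
        then \<rho>1 ''p'' j - \<rho>1 ''r'' 0 * \<rho>1 ''p'' ((\<nu>(''i'' := 0)) ''v'' +
          (j - ((\<nu>(''i'' := 0)) ''u'' + ((\<nu>(''i'' := 0)) ''a'' - (\<nu>(''i'' := 0)) ''b''))))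
        else \<rho>1 ''p'' j)"
    then have p: "\<rho>' ''p'' j = (if ?u + (?a - ?b) \<le> j \<and> j < ?u + ?a
        then \<rho> ''p'' j - h * \<rho> ''p'' (?v + (j - (?u + (?a - ?b)))) else \<rho> ''p'' j)" for j
      by (simp add: \<rho>1_def)
    have g: "\<rho>' ''p'' (?v + j) = \<rho> ''p'' (?v + j)" if "j < ?b" for j
      using disjoint that assms(2) by (auto simp: p)
    have lv: "\<rho>' ''p'' (?v + ?b - 1) = \<rho> ''p'' (?v + ?b - 1)" using g[of "?b - 1"] b(1) by simp
    have rv: "row (\<rho>' ''p'') ?v ?b = row (\<rho> ''p'') ?v ?b" using g by (rule row_cong)
    have "\<rho>' ''p'' (?u + (?a - ?b) + j) = \<rho> ''p'' (?u + (?a - ?b) + j)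
        - \<rho> ''p'' (?u + ?a - 1) / \<rho> ''p'' (?v + ?b - 1) * \<rho> ''p'' (?v + j)" if "j < ?b" for j
    proof -
      have "?u + (?a - ?b) \<le> ?u + (?a - ?b) + j \<and> ?u + (?a - ?b) + j < ?u + ?a"
        using that assms(2) by linarith
      then show ?thesis unfolding p h_def by simp
    qed
    moreover have "\<rho>' ''p'' (?u + j) = \<rho> ''p'' (?u + j)" if "j < ?a - ?b" for j
    proof -
      have "\<not> (?u + (?a - ?b) \<le> ?u + j \<and> ?u + j < ?u + ?a)" using that by linarith
      then show ?thesis unfolding p by (simp only: if_False)
    qed
    ultimately have el: "\<rho>' ''p'' (?u + ?a - 1) = 0"
      "row (\<rho>' ''p'') ?u ?a = row (\<rho> ''p'') ?u ?a + - monom h (?a - ?b) * row (\<rho> ''p'') ?v ?b"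
      unfolding h_def
      using row_elimination[of ?b ?a "\<rho> ''p''" ?v "\<rho>' ''p''" ?u] b assms(2) by blast+
    have t': "tracks p (\<nu> ''P'') (\<nu> ''Q'') (\<nu> ''e'') (row (\<rho>' ''p'') ?u ?a) (row (\<rho>' ''p'') ?v ?b)"
      unfolding el(2) rv using t tracks_add_mult[OF lead_row(3)[of ?b "\<rho> ''p''" ?v, OF b]] by blast
    \<comment> \<open>The row of \<open>f\<close> keeps its size \<open>a\<close> here, with top
      coefficient now 0, which is the situation \<open>wp_drop_zero\<close> handles.\<close>
    have "invariant p D (\<nu>(''i'' := ?b), \<rho>')"
      using assms(1) t' lv other by simp
    then have "wp drop_zero (\<nu>(''i'' := ?b), \<rho>') (\<lambda>n' t. R (1 + (?b * 2 + n')) t)"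
      by (rule wp_drop_zero) (use el(1) b(1) assms(2,3) in \<open>simp_all\<close>)
    then show "wp drop_zero (\<nu>(''i'' := 0, ''i'' := (\<nu>(''i'' := 0)) ''b''), \<rho>')
        (\<lambda>n' t. R (1 + ((\<nu>(''i'' := 0)) ''b'' * 2 + n')) t)"
      by simp
  qed (use assms(2) disjoint in simp_all)
  then show ?thesis
    unfolding eliminate_def lead_def
    by (intro wp_Seq wp_ROp wp_NAssign) (use b in \<open>simp_all add: \<rho>1_def h_def\<close>)
qed

lemma wp_restart:
  assumes "invariant p D (\<nu>, \<rho>)" "\<nu> ''a'' = 0" "1 < \<nu> ''b''"
    and "\<And>\<nu>' \<rho>'. invariant p D (\<nu>', \<rho>') \<Longrightarrow> \<nu>' ''a'' = \<nu> ''b'' \<Longrightarrow> \<nu>' ''b'' = \<nu> ''b'' - 1 \<Longrightarrow>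
      R ((\<nu> ''b'' - 1) * 2) (\<nu>', \<rho>')"
  shows "wp restart (\<nu>, \<rho>) R"
proof -
  let ?b = "\<nu> ''b''" and ?u = "\<nu> ''u''" and ?v = "\<nu> ''v''"
  define \<rho>1 where "\<rho>1 = \<rho>(''k'' := (\<rho> ''k'')(0 := 0))"
  have b: "0 < ?b" "\<rho> ''p'' (?v + ?b - 1) \<noteq> 0" "?b \<le> D" and e: "\<nu> ''e'' \<le> 1"
    and disjoint: "?u + ?b \<le> ?v \<or> ?v + ?b \<le> ?u"
    and one: "\<rho> ''one'' 0 = 1"
    and t: "tracks p (\<nu> ''P'') (\<nu> ''Q'') (\<nu> ''e'') 0 (row (\<rho> ''p'') ?v ?b)"
    using assms(1,2) by auto
  note l = lead_row[of ?b "\<rho> ''p''" ?v, OF b(1,2)]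
  have "wp (While (NLess (Plus (V ''i'') (N 1)) (V ''b'')) restart_body) (\<nu>(''i'' := 0), \<rho>1)
    (\<lambda>n s. wp restart_relabel s (\<lambda>n' t. R (n + n') t))"
  proof (rule wp_restart_loop)
    fix \<rho>'
    assume "\<And>x. x \<noteq> ''p'' \<Longrightarrow> x \<noteq> ''k'' \<Longrightarrow> \<rho>' x = \<rho>1 x"
    then have other: "\<rho>' ''z'' = \<rho> ''z''" "\<rho>' ''one'' = \<rho> ''one''" by (simp_all add: \<rho>1_def)
    assume "\<And>j. \<rho>' ''p'' j = (if (\<nu>(''i'' := 0)) ''u'' \<le> j \<and>
          j < (\<nu>(''i'' := 0)) ''u'' + ((\<nu>(''i'' := 0)) ''b'' - 1)
        then real (Suc (j - (\<nu>(''i'' := 0)) ''u'')) *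
          \<rho>1 ''p'' ((\<nu>(''i'' := 0)) ''v'' + Suc (j - (\<nu>(''i'' := 0)) ''u''))
        else \<rho>1 ''p'' j)"
    then have p: "\<rho>' ''p'' j = (if ?u \<le> j \<and> j < ?u + (?b - 1)
        then real (Suc (j - ?u)) * \<rho> ''p'' (?v + Suc (j - ?u)) else \<rho> ''p'' j)" for j
      by (simp add: \<rho>1_def del: of_nat_Suc)
    have g: "\<rho>' ''p'' (?v + j) = \<rho> ''p'' (?v + j)" if "j < ?b" for j
      using disjoint that by (auto simp: p)
    have rv: "row (\<rho>' ''p'') ?v ?b = row (\<rho> ''p'') ?v ?b" using g by (rule row_cong)
    have ru: "row (\<rho>' ''p'') ?u (?b - 1) = pderiv (row (\<rho> ''p'') ?v ?b)"
    proof (rule row_pderiv[OF b(1)])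
      fix j assume "j < ?b - 1"
      then have "?u \<le> ?u + j \<and> ?u + j < ?u + (?b - 1)" by linarith
      then show "\<rho>' ''p'' (?u + j) = real (Suc j) * \<rho> ''p'' (?v + Suc j)"
        unfolding p by (simp only: if_True simp_thms add_diff_cancel_left')
    qed
    \<comment> \<open>The leading coefficient of the derivative is nonzero because
      \<open>b > 1\<close>, so the derivative may serve as the new \<open>g\<close>.\<close>
    have "\<rho>' ''p'' (?u + (?b - 1) - 1) = real (?b - 1) * \<rho> ''p'' (?v + ?b - 1)"
    proof -
      obtain k where "?b = Suc (Suc k)" using assms(3) less_iff_Suc_add by auto
      then show ?thesis by (simp add: p del: of_nat_Suc)
    qed
    then have lu: "\<rho>' ''p'' (?u + (?b - 1) - 1) \<noteq> 0" using b(2) assms(3) by simp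
    have "degree (row (\<rho> ''p'') ?v ?b) \<ge> 1" using l(1) assms(3) by simp
    from tracks_restart[OF t this e]
    have tr: "\<nu> ''e'' = 1 \<Longrightarrow> tracks p (\<nu> ''Q'') (\<nu> ''P'' + 1) 1 (row (\<rho>' ''p'') ?v ?b) (row (\<rho>' ''p'') ?u (?b - 1))"
      "\<nu> ''e'' \<noteq> 1 \<Longrightarrow> tracks p (\<nu> ''P'') (\<nu> ''Q'' + 1) 1 (row (\<rho>' ''p'') ?v ?b) (row (\<rho>' ''p'') ?u (?b - 1))"
      unfolding rv ru by (simp_all split: if_splits)
    have par: "(?b + (?b - 1)) mod 2 = 1" using b(1) by (cases ?b) (simp_all add: mod2_eq_if)
    have inv: "invariant p D (\<nu>', \<rho>')"
      if "\<nu>' ''u'' = ?v" "\<nu>' ''v'' = ?u" "\<nu>' ''a'' = ?b" "\<nu>' ''b'' = ?b - 1" "\<nu>' ''c'' = 1" "\<nu>' ''e'' = 1"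
        "tracks p (\<nu>' ''P'') (\<nu>' ''Q'') 1 (row (\<rho>' ''p'') ?v ?b) (row (\<rho>' ''p'') ?u (?b - 1))" for \<nu>'
    proof -
      have uv: "?v = 0 \<and> ?u = D \<or> ?v = D \<and> ?u = 0" and z: "\<rho> ''z'' 0 = 0"
        using assms(1) by auto
      have "0 < ?b - 1" "?b - 1 \<le> D" using assms(3) b(3) by simp_all
      with uv z lu par[symmetric] b(3) one show ?thesis
        unfolding invariant.simps that(1-6) other using that(7) order.refl[of "1::nat"] by metis
    qed
    have "wp restart_relabel (\<nu>(''i'' := ?b - 1), \<rho>') (\<lambda>n' t. R ((?b - 1) * 2 + n') t)"
      unfolding restart_relabel_def increment_def
      apply (rule wp_Seq, rule wp_exchange, simp, simp, simp)
      apply (rule wp_Seq, rule wp_NAssign, simp)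
      apply (rule wp_Seq, rule wp_NAssign, simp)
      apply (rule wp_Seq, rule wp_NAssign, simp)
      apply (rule wp_Seq, rule wp_If)
      subgoal
        apply (rule wp_exchange, simp, simp, simp)
        apply (rule wp_Seq, rule wp_NAssign, simp)
        apply (rule wp_NAssign, simp)
        apply (rule assms(4)[unfolded One_nat_def]; (rule inv)?)
        using tr(1) e by simp_all
      subgoal
        apply (rule wp_Skip, simp)
        apply (rule wp_Seq, rule wp_NAssign, simp)
        apply (rule wp_NAssign, simp)
        apply (rule assms(4)[unfolded One_nat_def]; (rule inv)?)
        using tr(2) by simp_all
      done
    then show "wp restart_relabel (\<nu>(''i'' := 0, ''i'' := (\<nu>(''i'' := 0)) ''b'' - 1), \<rho>')
        (\<lambda>n' t. R (((\<nu>(''i'' := 0)) ''b'' - 1) * 2 + n') t)"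
      by simp
  qed (use disjoint one in \<open>auto simp: \<rho>1_def\<close>)
  then show ?thesis
    unfolding restart_def
    by (intro wp_Seq wp_RConst wp_NAssign) (simp add: \<rho>1_def)
qed


lemma wp_step:
  assumes "invariant p D (\<nu>, \<rho>)" "1 < \<nu> ''a'' + \<nu> ''b''"
    and "\<And>n \<nu>' \<rho>'. invariant p D (\<nu>', \<rho>') \<Longrightarrow>
      n + potential D (\<nu>' ''a'') (\<nu>' ''b'') \<le> potential D (\<nu> ''a'') (\<nu> ''b'') \<Longrightarrow>
      potential D (\<nu>' ''a'') (\<nu>' ''b'') < potential D (\<nu> ''a'') (\<nu> ''b'') \<Longrightarrow> R n (\<nu>', \<rho>')"
  shows "wp step (\<nu>, \<rho>) R"
proof -
  let ?a = "\<nu> ''a''" and ?b = "\<nu> ''b''"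
  have b: "0 < ?b" "?b \<le> D" and z: "\<rho> ''z'' 0 = 0" using assms(1) by simp_all
  show ?thesis
    unfolding step_def
  proof (intro wp_If, goal_cases)
    case 1
    then have "0 < ?a" "\<rho> ''p'' (\<nu> ''u'' + ?a - 1) = 0" using z by (simp_all add: lead_def)
    then show ?case
      using potential_drop_zero[of ?a ?b D] b
      by (intro wp_drop_zero[OF assms(1)]) (auto intro!: assms(3) simp: lead_def simp del: invariant.simps)
  next
    case 2
    then have "0 < ?a" "\<rho> ''p'' (\<nu> ''u'' + ?a - 1) \<noteq> 0" "?a < ?b"
      using z by (simp_all add: lead_def)
    then show ?case
      using potential_reciprocity[of ?a ?b D]
      by (intro wp_reciprocity[OF assms(1)]) (auto intro!: assms(3) simp: lead_def simp del: invariant.simps)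
  next
    case 3
    \<comment> \<open>The zero test costs 1 and the elimination \<open>2 * b + 1\<close>, together
      at most \<open>2 * D + 2\<close>.\<close>
    then have "?b \<le> ?a" by simp
    then show ?case
      using potential_eliminate[of ?b ?a D] b
      by (intro wp_eliminate[OF assms(1)]) (auto intro!: assms(3) simp: lead_def simp del: invariant.simps)
  next
    case 4
    then have "?a = 0" "1 < ?b" using assms(2) by simp_all
    then show ?case
      using potential_restart[of ?b D] b
      by (intro wp_restart[OF assms(1)]) (auto intro!: assms(3) simp del: invariant.simps)
  qed
qed

theorem mainTheorem3:
  "\<exists>(prog :: com) (C :: nat). \<forall>p :: real poly.
     degree p \<ge> 1 \<and> lead_coeff p = 1 \<longrightarrow>
     (\<exists>n t. exec prog (input_state p) n t \<and>
        n \<le> C * (degree p)\<^sup>2 \<and>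
        (if \<forall>x :: real. poly p x \<ge> 0 then accepting t else rejecting t))"
proof (rule exI[of _ nonneg_test], rule exI[of _ 48], intro allI impI)
  fix p :: "real poly"
  assume p: "degree p \<ge> 1 \<and> lead_coeff p = 1"
  let ?D = "degree p + 1"
  let ?R = "\<lambda>n t. n \<le> 48 * (degree p)\<^sup>2 \<and>
    (if \<forall>x :: real. poly p x \<ge> 0 then accepting t else rejecting t)"
  let ?\<nu> = "(\<lambda>x. 0)(''d'' := degree p, ''u'' := ?D, ''b'' := ?D)"
  let ?\<rho> = "(\<lambda>x i. 0)(''p'' := coeff p, ''one'' := (\<lambda>i. 0)(0 := 1))"
  have row_p: "row (coeff p) 0 ?D = p"
    by (rule poly_eqI) (auto simp: coeff_row coeff_eq_0)
  have init: "invariant p ?D (?\<nu>, ?\<rho>)"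
    using p tracks_init[of p] row_p by simp
  \<comment> \<open>This is the initial potential. As the degree is at least 1, its square dominates
    the linear and the constant term, and \<open>8 + 24 + 16 = 48\<close>.\<close>
  have "4 * (2 * ?D + 2) * ?D = 8 * (degree p)\<^sup>2 + 24 * degree p + 16"
    by (simp add: power2_eq_square algebra_simps)
  also have "\<dots> \<le> 48 * (degree p)\<^sup>2"
  proof -
    have "degree p * 1 \<le> degree p * degree p" "1 * 1 \<le> degree p * degree p"
      using p by (intro mult_le_mono; simp)+
    then show ?thesis unfolding power2_eq_square by linarith
  qed
  finally have bound: "potential ?D 0 ?D \<le> 48 * (degree p)\<^sup>2" by (simp add: potential_def)
  have "wp (While (NLess (N 1) (Plus (V ''a'') (V ''b''))) step) (?\<nu>, ?\<rho>)
    (\<lambda>n s. wp verdict s (\<lambda>n' t. ?R (n + n') t))"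
  proof (rule wp_while_potential[where I = "invariant p ?D"
        and pot = "\<lambda>s. potential ?D (fst s ''a'') (fst s ''b'')"])
    fix s assume s: "invariant p ?D s" "bval (NLess (N 1) (Plus (V ''a'') (V ''b''))) s"
    obtain \<nu> \<rho> where "s = (\<nu>, \<rho>)" by (cases s)
    with s show "wp step s (\<lambda>n t. invariant p ?D t \<and>
        n + potential ?D (fst t ''a'') (fst t ''b'') \<le> potential ?D (fst s ''a'') (fst s ''b'') \<and>
        potential ?D (fst t ''a'') (fst t ''b'') < potential ?D (fst s ''a'') (fst s ''b''))"
      by (auto intro!: wp_step simp del: invariant.simps)
  next
    fix n s
    assume s: "invariant p ?D s" "\<not> bval (NLess (N 1) (Plus (V ''a'') (V ''b''))) s"
      and n: "n \<le> potential ?D (fst (?\<nu>, ?\<rho>) ''a'') (fst (?\<nu>, ?\<rho>) ''b'')"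
    obtain \<nu> \<rho> where e: "s = (\<nu>, \<rho>)" by (cases s)
    \<comment> \<open>Since \<open>b > 0\<close>, the failed guard leaves only the pair of 0 and a
      nonzero constant, where \<open>tracks_const\<close> reads off the answer.\<close>
    have ab: "\<nu> ''a'' = 0" "\<nu> ''b'' = 1" using s unfolding e by simp_all
    have "tracks p (\<nu> ''P'') (\<nu> ''Q'') (\<nu> ''e'') 0 (row (\<rho> ''p'') (\<nu> ''v'') 1)"
      and "\<rho> ''p'' (\<nu> ''v'' + 1 - 1) \<noteq> 0"
      using s(1) ab unfolding e by simp_all
    then have "odd_roots 0 p = 0 \<longleftrightarrow> \<nu> ''P'' = \<nu> ''Q''"
      using lead_row[of 1 "\<rho> ''p''" "\<nu> ''v''"] by (intro tracks_const) simp_all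
    then have "(\<forall>x. poly p x \<ge> 0) \<longleftrightarrow> \<nu> ''P'' = \<nu> ''Q''"
      using nonneg_iff_odd_roots[of p] p by simp
    then show "wp verdict s (\<lambda>n' t. ?R (n + n') t)"
      unfolding e verdict_def using n bound
      by (intro wp_NAssign) (auto simp: accepting_def rejecting_def)
  qed (rule bcost.simps, rule init)
  then have "wp nonneg_test (input_state p) ?R"
    unfolding nonneg_test_def input_state_def
    by (intro wp_Seq wp_RConst wp_NAssign) simp
  then show "\<exists>n t. exec nonneg_test (input_state p) n t \<and> ?R n t"
    unfolding wp_def by blast
qed

end
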